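(* Any Poisson structure in the two-parameter family $\mathcal P_{\alpha,\beta}$ of Poisson brackets on the Grassmannian $G_k(n)$ is compatible with the cluster algebra $\mathcal A_{G_k^0(n)}$.
   Context: **The family $\mathcal P_{\alpha,\beta}$.** $G_k(n)$ is the Grassmannian of $k$-dimensional subspaces of $\mathbb R^n$ (row spans of $k\times n$ matrices), $m=n-k$. For $I=\{i_1<\dots<i_k\}\subset\{1,\dots,n\}$ and $J$ its complement, $G_k^I(n)$ is the cell where the Plücker coordinate $x_I$ does not vanish, with coordinates $m^I_{pj}$ ($1\le p\le k$, $j\in J$): the $(p,j)$-entry of the unique matrix representative whose columns indexed by $I$ form the identity matrix. For real $\alpha,\beta$, $\mathcal P_{\alpha,\beta}$ is the unique Poisson bracket on $G_k(n)$ whose restriction to each cell $G_k^I(n)$ is $$\{m^I_{pj},m^I_{\bar p\bar\jmath}\}=(\alpha-\beta)\,s_=(i_p,j,i_{\bar p},\bar\jmath)\,m^I_{p\bar\jmath}m^I_{\bar pj}+(\alpha+\beta)\,s_\times(i_p,j,i_{\bar p},\bar\jmath)\,m^I_{pj}m^I_{\bar p\bar\jmath}.$$ Here $a\prec b\prec c\prec\cdots$ means that the (distinct) indices occur in this cyclic order modulo $n$, and for $i,i'\in I$, $j,j'\in J$, $$s_=(i,j,i',j')=\begin{cases}1&\text{if } i\prec i'\prec j'\prec j,\\ -1&\text{if } i'\prec i\prec j\prec j',\\ \tfrac12&\text{if } i=i'\prec j'\prec j\text{ or } i\prec i'\prec j'=j,\\ -\tfrac12&\text{if } i'=i\prec j\prec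 j'\text{ or } i'\prec i\prec j=j',\\ 0&\text{otherwise,}\end{cases}$$ $$s_\times(i,j,i',j')=\begin{cases}1&\text{if } i'\prec i\prec j'\prec j,\\ -1&\text{if } i\prec i'\prec j\prec j',\\ \tfrac12&\text{if } i'=i\prec j'\prec j\text{ or } i'\prec i\prec j'=j,\\ -\tfrac12&\text{if } i=i'\prec j\prec j'\text{ or } i\prec i'\prec j=j',\\ 0&\text{otherwise.}\end{cases}$$ **Cluster algebras of geometric type.** A seed with $r$ cluster variables and $s$ stable variables in a field $\mathfrak F$ of rational functions in $r+s$ variables is a pair $(\mathbf x,\widetilde B)$, $\mathbf x=(x_1,\dots,x_r)$ the cluster, $x_{r+1},\dots,x_{r+s}$ the stable variables (which are the same for all seeds), $\widetilde{\mathbf x}=(x_1,\dots,x_{r+s})$ (the extended cluster) algebraically independent generators of $\mathfrak F$, and $\widetilde B=(b_{ij})$ an $r\times(r+s)$ integer matrix whose first $r$ columns form a skew-symmetric matrix. The adjacent seed in direction $l\in\{1,\dots,r\}$ replaces $x_l$ by $x_l'$, where $$x_lx_l'=\prod_{b_{li}>0}x_i^{b_{li}}+\prod_{b_{li}<0}x_i^{-b_{li}},$$ and $\widetilde B$ by $\widetilde B'$ with $b'_{ij}=-b_{ij}$ if $i=l$ or $j=l$, and $b'_{ij}=b_{ij}+\frac{|b_{il}|b_{lj}+b_{il}|b_{lj}|}{2}$ otherwise. Seeds connected by sequences of adjacent seeds are mutation equivalent; the cluster algebra is the subalgebra of $\mathfrak F$ generated by all cluster variables in all seeds mutation equivalent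 to the initial one, over the ring of Laurent polynomials in the stable variables with integer coefficients. **Compatibility.** A Poisson bracket on $\mathfrak F$ is compatible with the cluster algebra if for every extended cluster $\widetilde{\mathbf x}=(x_1,\dots,x_{r+s})$ one has $\{x_i,x_j\}=\omega_{ij}x_ix_j$ with constants $\omega_{ij}$ for all $i,j$. **The cluster algebra $\mathcal A_{G_k^0(n)}$.** $G_k^0(n)=\{x_{[1,k]}\neq0\}$ is the open cell, parametrized by $k\times m$ matrices $Y=(y_{ij})$ via representatives $[\mathbf 1_k\ Y]$; $\mathfrak F$ is the field of rational functions on $G^0_k(n)$. For $1\le i\le k$, $1\le j\le m$ let $l(i,j)=\min(i-1,m-j)$, let $F_{ij}$ be the minor of $Y$ with rows $i-l(i,j),\dots,i$ and columns $j,\dots,j+l(i,j)$, and $f_{ij}=(-1)^{(k-i)(l(i,j)-1)}F_{ij}$. The initial extended cluster is $\{f_{ij}\}$; the stable variables are $f_{11},f_{21},\dots,f_{k1},f_{k2},\dots,f_{km}$, and the other $f_{ij}$ ($1\le i\le k-1$, $2\le j\le m$) are the cluster variables. The matrix $\widetilde B$ has entries $0,\pm1$ encoded by the directed graph on the vertices $(i,j)\in[1,k]\times[1,m]$ with edges $(i,j)\to(i,j+1)$, $(i+1,j)\to(i,j)$, $(i,j)\to(i+1,j-1)$ (whenever both ends lie in the array, edges between two stable vertices being disregarded): for a cluster vertex $a$ and any vertex $b$, the entry in row $a$, column $b$ is $1$ if $a\to b$, $-1$ if $b\to a$, and $0$ otherwise. *)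

theory Defs
  imports
    Complex_Main
    "HOL-Library.Poly_Mapping"
    "HOL-Library.Nat_Bijection"
    "HOL-Computational_Algebra.Fraction_Field"
    "Jordan_Normal_Form.Matrix"
    "Jordan_Normal_Form.Determinant"
begin

section \<open>The field of rational functions on the open cell\<close>

text \<open>
  Polynomials over the reals in countably many variables are finitely supported functions from
  monomials (finitely supported exponent vectors) to coefficients. The variable \<open>y\<^sub>i\<^sub>j\<close> has number
  \<open>prod_encode (i, j)\<close>.
\<close>

type_synonym mpoly = "(nat \<Rightarrow>\<^sub>0 nat) \<Rightarrow>\<^sub>0 real"
type_synonym ratfun = "mpoly fract"

definition const :: "real \<Rightarrow> ratfun" where
  "const c = Fract (Poly_Mapping.single 0 c) 1"

definition yvar :: "nat \<Rightarrow> nat \<Rightarrow> ratfun" where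
  "yvar i j = Fract (Poly_Mapping.single (Poly_Mapping.single (prod_encode (i, j)) 1) 1) 1"

definition cell_polys :: "nat \<Rightarrow> nat \<Rightarrow> mpoly set" where
  "cell_polys k m =
     {p. \<forall>t \<in> Poly_Mapping.keys p. Poly_Mapping.keys t \<subseteq> prod_encode ` ({1..k} \<times> {1..m})}"

text \<open>
  The field of rational functions in the \<open>y\<^sub>i\<^sub>j\<close> with \<open>1 \<le> i \<le> k\<close> and \<open>1 \<le> j \<le> m\<close>, as a subfield
  of the ambient type. As the open cell is dense, this is also the field of rational functions
  on the Grassmannian of \<open>k\<close>-dimensional subspaces of \<open>(k+m)\<close>-dimensional space.
\<close>

definition cell_field :: "nat \<Rightarrow> nat \<Rightarrow> ratfun set" where
  "cell_field k m = {Fract p q | p q. p \<in> cell_polys k m \<and> q \<in> cell_polys k m \<and> q \<noteq> 0}"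

definition poisson_bracket_on :: "ratfun set \<Rightarrow> (ratfun \<Rightarrow> ratfun \<Rightarrow> ratfun) \<Rightarrow> bool" where
  "poisson_bracket_on F br \<longleftrightarrow>
     (\<forall>f\<in>F. \<forall>g\<in>F. br f g \<in> F) \<and>
     (\<forall>f\<in>F. \<forall>g\<in>F. \<forall>h\<in>F. br (f + g) h = br f h + br g h) \<and>
     (\<forall>c. \<forall>f\<in>F. \<forall>g\<in>F. br (const c * f) g = const c * br f g) \<and>
     (\<forall>f\<in>F. \<forall>g\<in>F. br f g = - br g f) \<and>
     (\<forall>f\<in>F. \<forall>g\<in>F. \<forall>h\<in>F. br (f * g) h = f * br g h + br f h * g) \<and>
     (\<forall>f\<in>F. \<forall>g\<in>F. \<forall>h\<in>F. br f (br g h) + br g (br h f) + br h (br f g) = 0)"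

section \<open>The brackets on the Grassmannian\<close>

text \<open>Distinct indices in cyclic order: some rotation of the list is strictly increasing.\<close>

definition cyc :: "nat list \<Rightarrow> bool" where
  "cyc xs \<longleftrightarrow> (\<exists>r. sorted_wrt (<) (rotate r xs))"

definition s_par :: "nat \<Rightarrow> nat \<Rightarrow> nat \<Rightarrow> nat \<Rightarrow> real" where
  "s_par i j i' j' =
     (if cyc [i, i', j', j] then 1
      else if cyc [i', i, j, j'] then -1
      else if (i = i' \<and> cyc [i, j', j]) \<or> (j' = j \<and> cyc [i, i', j]) then 1/2
      else if (i' = i \<and> cyc [i, j, j']) \<or> (j = j' \<and> cyc [i', i, j]) then -1/2
      else 0)"

definition s_cross :: "nat \<Rightarrow> nat \<Rightarrow> nat \<Rightarrow> nat \<Rightarrow> real" where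
  "s_cross i j i' j' =
     (if cyc [i', i, j', j] then 1
      else if cyc [i, i', j, j'] then -1
      else if (i' = i \<and> cyc [i, j', j]) \<or> (j' = j \<and> cyc [i', i, j]) then 1/2
      else if (i = i' \<and> cyc [i, j, j']) \<or> (j = j' \<and> cyc [i, i', j]) then -1/2
      else 0)"

text \<open>
  The representative \<open>[1 Y]\<close> of the generic point of the open cell. Matrices of the library are
  indexed from 0; all other indices here start at 1.
\<close>

definition generic_matrix :: "nat \<Rightarrow> nat \<Rightarrow> ratfun mat" where
  "generic_matrix k n =
     mat k n (\<lambda>(p, c). if c < k then (if p = c then 1 else 0) else yvar (p + 1) (c + 1 - k))"

text \<open>The \<open>p\<close>-th smallest element of \<open>I\<close>.\<close>

definition nth_elem :: "nat set \<Rightarrow> nat \<Rightarrow> nat" where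
  "nth_elem I p = sorted_list_of_set I ! (p - 1)"

text \<open>
  The representatives of the generic point are the matrices with the same row span, i.e. its
  multiples by invertible matrices from the left; exactly one of them has the identity matrix in
  the columns indexed by \<open>I\<close>.
\<close>

definition cell_matrix :: "nat \<Rightarrow> nat \<Rightarrow> nat set \<Rightarrow> ratfun mat" where
  "cell_matrix k n I =
     (THE M. (\<exists>A \<in> carrier_mat k k. invertible_mat A \<and> M = A * generic_matrix k n) \<and>
             (\<forall>p \<in> {1..k}. \<forall>q \<in> {1..k}.
                M $$ (p - 1, nth_elem I q - 1) = (if p = q then 1 else 0)))"

definition cell_coord :: "nat \<Rightarrow> nat \<Rightarrow> nat set \<Rightarrow> nat \<Rightarrow> nat \<Rightarrow> ratfun" where
  "cell_coord k n I p j = cell_matrix k n I $$ (p - 1, j - 1)"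

text \<open>
  A Poisson bracket on the Grassmannian is represented by the bracket it induces on the field of
  rational functions. The formula is required on every cell, hence the bracket preserves the
  coordinate ring of each cell, and it is determined on the whole Grassmannian.
\<close>

definition grassmannian_bracket ::
    "nat \<Rightarrow> nat \<Rightarrow> real \<Rightarrow> real \<Rightarrow> (ratfun \<Rightarrow> ratfun \<Rightarrow> ratfun) \<Rightarrow> bool" where
  "grassmannian_bracket k n \<alpha> \<beta> br \<longleftrightarrow>
     poisson_bracket_on (cell_field k (n - k)) br \<and>
     (\<forall>I. I \<subseteq> {1..n} \<and> card I = k \<longrightarrow>
        (\<forall>p \<in> {1..k}. \<forall>p' \<in> {1..k}. \<forall>j \<in> {1..n} - I. \<forall>j' \<in> {1..n} - I.
           br (cell_coord k n I p j) (cell_coord k n I p' j') =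
             const ((\<alpha> - \<beta>) * s_par (nth_elem I p) j (nth_elem I p') j')
               * cell_coord k n I p j' * cell_coord k n I p' j
             + const ((\<alpha> + \<beta>) * s_cross (nth_elem I p) j (nth_elem I p') j')
               * cell_coord k n I p j * cell_coord k n I p' j'))"

section \<open>Cluster algebras of geometric type\<close>

text \<open>
  Extended clusters and exchange matrices are indexed by the finite sets \<open>cluster_ix\<close> and
  \<open>stable_ix\<close> instead of initial segments of the natural numbers. Only rows of \<open>exch\<close> indexed by
  \<open>cluster_ix\<close> and columns indexed by \<open>cluster_ix \<union> stable_ix\<close> belong to the exchange matrix.
\<close>

record ('v, 'f) seed =
  cluster_ix :: "'v set"
  stable_ix :: "'v set"
  var :: "'v \<Rightarrow> 'f"
  exch :: "'v \<Rightarrow> 'v \<Rightarrow> int"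

definition all_ix :: "('v, 'f) seed \<Rightarrow> 'v set" where
  "all_ix S = cluster_ix S \<union> stable_ix S"

definition exchange_var :: "('v, 'f::field) seed \<Rightarrow> 'v \<Rightarrow> 'f" where
  "exchange_var S l =
     ((\<Prod>i \<in> {i \<in> all_ix S. exch S l i > 0}. var S i ^ nat (exch S l i)) +
      (\<Prod>i \<in> {i \<in> all_ix S. exch S l i < 0}. var S i ^ nat (- exch S l i))) / var S l"

text \<open>The expression divided by 2 is always even, so \<open>div\<close> is exact division.\<close>

definition exchange_mat :: "('v, 'f) seed \<Rightarrow> 'v \<Rightarrow> 'v \<Rightarrow> 'v \<Rightarrow> int" where
  "exchange_mat S l i j =
     (let b = exch S in
      if i = l \<or> j = l then - b i j
      else b i j + (\<bar>b i l\<bar> * b l j + b i l * \<bar>b l j\<bar>) div 2)"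

definition adjacent_seed :: "('v, 'f::field) seed \<Rightarrow> 'v \<Rightarrow> ('v, 'f) seed" where
  "adjacent_seed S l = S\<lparr>var := (var S)(l := exchange_var S l), exch := exchange_mat S l\<rparr>"

inductive mutation_equivalent :: "('v, 'f::field) seed \<Rightarrow> ('v, 'f) seed \<Rightarrow> bool"
  for S :: "('v, 'f) seed" where
  refl: "mutation_equivalent S S"
| step: "mutation_equivalent S T \<Longrightarrow> l \<in> cluster_ix T \<Longrightarrow> mutation_equivalent S (adjacent_seed T l)"

text \<open>Compatibility with the cluster algebra defined by the initial seed \<open>S\<close>.\<close>

definition compatible :: "(ratfun \<Rightarrow> ratfun \<Rightarrow> ratfun) \<Rightarrow> ('v, ratfun) seed \<Rightarrow> bool" where
  "compatible br S \<longleftrightarrow>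
     (\<forall>T. mutation_equivalent S T \<longrightarrow>
        (\<forall>i \<in> all_ix T. \<forall>j \<in> all_ix T. \<exists>\<omega>::real. br (var T i) (var T j) = const \<omega> * var T i * var T j))"

section \<open>The initial seed on the open cell\<close>

definition minor_l :: "nat \<Rightarrow> nat \<Rightarrow> nat \<Rightarrow> nat" where
  "minor_l m i j = min (i - 1) (m - j)"

definition minor_F :: "nat \<Rightarrow> nat \<Rightarrow> nat \<Rightarrow> ratfun" where
  "minor_F m i j =
     (let l = minor_l m i j in
      det (mat (l + 1) (l + 1) (\<lambda>(a, b). yvar (i - l + a) (j + b))))"

text \<open>The exponent is an integer, since \<open>l(i,j) - 1\<close> may be \<open>-1\<close>.\<close>

definition signed_f :: "nat \<Rightarrow> nat \<Rightarrow> nat \<Rightarrow> nat \<Rightarrow> ratfun" where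
  "signed_f k m i j = (-1) powi ((int k - int i) * (int (minor_l m i j) - 1)) * minor_F m i j"

inductive arrow :: "nat \<times> nat \<Rightarrow> nat \<times> nat \<Rightarrow> bool" where
  "arrow (i, j) (i, j + 1)"
| "arrow (i + 1, j) (i, j)"
| "arrow (i, j + 1) (i + 1, j)"

definition grassmannian_seed :: "nat \<Rightarrow> nat \<Rightarrow> (nat \<times> nat, ratfun) seed" where
  "grassmannian_seed k n =
     \<lparr>cluster_ix = {1..k - 1} \<times> {2..n - k},
      stable_ix = {1..k} \<times> {1..n - k} - {1..k - 1} \<times> {2..n - k},
      var = (\<lambda>(i, j). signed_f k (n - k) i j),
      exch = (\<lambda>a b. if arrow a b then 1 else if arrow b a then -1 else 0)\<rparr>"

end

theory Submission
  imports Defs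
begin

text \<open>
  On the standard cell the bracket of \<open>y\<^sub>i\<^sub>j\<close> is a multiple of a Sklyanin bracket plus a toric term. For
  two minors \<open>f\<close>, \<open>g\<close> the toric term is log-canonical, and the Sklyanin term consists of a signed sum
  of all row exchanges and one of all column exchanges between \<open>f\<close> and \<open>g\<close>; the unsigned sums
  coincide. For the minors of the initial cluster the sign of the nonzero row exchanges is constant
  and opposite to that of the column exchanges, so the exchanges cancel and leave
  \<open>\<plusminus> (\<bar>C \<inter> C'\<bar> - \<bar>A \<inter> A'\<bar>) f g\<close>, where \<open>A\<close>, \<open>A'\<close> are the sets of rows and \<open>C\<close>, \<open>C'\<close> those of columns.

  With the resulting matrix \<open>\<omega>\<close>, the exchange matrix \<open>B\<close> of the initial seed satisfies
  \<open>B \<omega> = (\<alpha> - \<beta>) (\<one> 0)\<close>. By the argument of Gekhtman, Shapiro and Vainshtein this identity together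
  with log-canonicity is inherited by adjacent seeds: it makes both monomials of an exchange relation
  have the same bracket with every other variable.
\<close>

section \<open>The subfield of rational functions on the cell\<close>

lemma const_add: "const (a + b) = const a + const b"
  by (simp add: const_def single_add)

lemma const_mult: "const (a * b) = const a * const b"
  by (simp add: const_def mult_single)

lemma const_0 [simp]: "const 0 = 0"
  by (simp add: const_def fract_collapse)

lemma const_1 [simp]: "const 1 = 1"
  by (simp add: const_def One_fract_def)

lemma const_uminus: "const (- a) = - const a"
  by (metis add.right_inverse const_0 const_add minus_unique)

lemma const_diff: "const (a - b) = const a - const b"
  by (metis const_add const_uminus diff_conv_add_uminus)

lemma const_sum: "const (sum f A) = (\<Sum>a\<in>A. const (f a))"
  by (induction A rule: infinite_finite_induct) (simp_all add: const_add)

lemma const_of_nat: "const (of_nat n) = of_nat n"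
  by (induction n) (simp_all add: const_add)

lemma cell_polys_add:
  assumes "p \<in> cell_polys k m" "q \<in> cell_polys k m"
  shows "p + q \<in> cell_polys k m"
  using assms Poly_Mapping.keys_add[of p q] unfolding cell_polys_def by blast

lemma cell_polys_mult:
  assumes "p \<in> cell_polys k m" "q \<in> cell_polys k m"
  shows "p * q \<in> cell_polys k m"
  unfolding cell_polys_def mem_Collect_eq
proof
  fix t assume "t \<in> Poly_Mapping.keys (p * q)"
  then obtain a b where t: "t = a + b"
    and ab: "a \<in> Poly_Mapping.keys p" "b \<in> Poly_Mapping.keys q"
    using keys_mult[of p q] by blast
  have "Poly_Mapping.keys t \<subseteq> Poly_Mapping.keys a \<union> Poly_Mapping.keys b"
    unfolding t by (rule Poly_Mapping.keys_add)
  then show "Poly_Mapping.keys t \<subseteq> prod_encode ` ({1..k} \<times> {1..m})"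
    using assms ab unfolding cell_polys_def by blast
qed

lemma cell_polys_const: "Poly_Mapping.single 0 c \<in> cell_polys k m"
  by (simp add: cell_polys_def)

lemma cell_polys_1: "1 \<in> cell_polys k m"
  by (simp add: cell_polys_def)

lemma cell_field_add:
  assumes "f \<in> cell_field k m" "g \<in> cell_field k m"
  shows "f + g \<in> cell_field k m"
proof -
  obtain p q p' q' where "f = Fract p q" "g = Fract p' q'" "q \<noteq> 0" "q' \<noteq> 0"
    "p \<in> cell_polys k m" "q \<in> cell_polys k m" "p' \<in> cell_polys k m" "q' \<in> cell_polys k m"
    using assms unfolding cell_field_def by blast
  moreover from this have "f + g = Fract (p * q' + p' * q) (q * q')"
    by simp
  ultimately show ?thesis
    unfolding cell_field_def by (auto intro!: exI cell_polys_add cell_polys_mult)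
qed

lemma cell_field_mult:
  assumes "f \<in> cell_field k m" "g \<in> cell_field k m"
  shows "f * g \<in> cell_field k m"
proof -
  obtain p q p' q' where "f = Fract p q" "g = Fract p' q'" "q \<noteq> 0" "q' \<noteq> 0"
    "p \<in> cell_polys k m" "q \<in> cell_polys k m" "p' \<in> cell_polys k m" "q' \<in> cell_polys k m"
    using assms unfolding cell_field_def by blast
  moreover from this have "f * g = Fract (p * p') (q * q')"
    by simp
  ultimately show ?thesis
    unfolding cell_field_def by (auto intro!: exI cell_polys_mult)
qed

lemma cell_field_inverse:
  assumes "f \<in> cell_field k m"
  shows "inverse f \<in> cell_field k m"
proof -
  obtain p q where pq: "f = Fract p q" "q \<noteq> 0" "p \<in> cell_polys k m" "q \<in> cell_polys k m"
    using assms unfolding cell_field_def by blast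
  show ?thesis
  proof (cases "p = 0")
    case True
    then have "inverse f = f"
      using pq by (simp add: fract_collapse)
    then show ?thesis using assms by simp
  next
    case False
    then show ?thesis
      using pq unfolding cell_field_def by auto
  qed
qed

lemma cell_field_const: "const c \<in> cell_field k m"
  unfolding cell_field_def const_def using cell_polys_const cell_polys_1 by fastforce

lemma cell_field_yvar:
  assumes "i \<in> {1..k}" "j \<in> {1..m}"
  shows "yvar i j \<in> cell_field k m"
proof -
  have "Poly_Mapping.single (Poly_Mapping.single (prod_encode (i, j)) 1) 1 \<in> cell_polys k m"
    using assms by (simp add: cell_polys_def)
  then show ?thesis
    unfolding cell_field_def yvar_def using cell_polys_1 by fastforce
qed

section \<open>Brackets as biderivations\<close>

text \<open>The bracket is constrained on \<open>F\<close> alone, so a rational function has to be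
  shown to lie in \<open>F\<close> before a rule of the bracket applies to it.\<close>

locale poisson_subfield =
  fixes F :: "ratfun set" and br :: "ratfun \<Rightarrow> ratfun \<Rightarrow> ratfun"
  assumes const_in [simp, intro]: "const c \<in> F"
    and add_in [simp, intro]: "f \<in> F \<Longrightarrow> g \<in> F \<Longrightarrow> f + g \<in> F"
    and mult_in [simp, intro]: "f \<in> F \<Longrightarrow> g \<in> F \<Longrightarrow> f * g \<in> F"
    and inverse_in [simp, intro]: "f \<in> F \<Longrightarrow> inverse f \<in> F"
    and bracket: "poisson_bracket_on F br"
begin

lemma zero_in [simp, intro]: "0 \<in> F"
  by (metis const_0 const_in)

lemma one_in [simp, intro]: "1 \<in> F"
  by (metis const_1 const_in)

lemma uminus_in [simp, intro]: "f \<in> F \<Longrightarrow> - f \<in> F"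
  by (metis const_1 const_in const_uminus mult_in mult_minus1)

lemma sum_in [intro]: "(\<And>a. a \<in> A \<Longrightarrow> f a \<in> F) \<Longrightarrow> sum f A \<in> F"
  by (induction A rule: infinite_finite_induct) auto

lemma prod_in [intro]: "(\<And>a. a \<in> A \<Longrightarrow> f a \<in> F) \<Longrightarrow> prod f A \<in> F"
  by (induction A rule: infinite_finite_induct) auto

lemma power_in [simp, intro]: "f \<in> F \<Longrightarrow> f ^ n \<in> F"
  by (induction n) auto

lemma br_add: "f \<in> F \<Longrightarrow> g \<in> F \<Longrightarrow> h \<in> F \<Longrightarrow> br (f + g) h = br f h + br g h"
  using bracket unfolding poisson_bracket_on_def by blast

lemma br_const_mult: "f \<in> F \<Longrightarrow> g \<in> F \<Longrightarrow> br (const c * f) g = const c * br f g"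
  using bracket unfolding poisson_bracket_on_def by blast

lemma br_antisym: "f \<in> F \<Longrightarrow> g \<in> F \<Longrightarrow> br f g = - br g f"
  using bracket unfolding poisson_bracket_on_def by blast

lemma br_mult: "f \<in> F \<Longrightarrow> g \<in> F \<Longrightarrow> h \<in> F \<Longrightarrow> br (f * g) h = f * br g h + br f h * g"
  using bracket unfolding poisson_bracket_on_def by blast

lemma br_0 [simp]: "h \<in> F \<Longrightarrow> br 0 h = 0"
  using br_const_mult[of 0 h 0] by simp

lemma br_1 [simp]:
  assumes "h \<in> F"
  shows "br 1 h = 0"
proof -
  have "br 1 h = br 1 h + br 1 h"
    using br_mult[of 1 1 h] assms by (metis mult_1 mult_1_right one_in)
  then show ?thesis by (metis add_cancel_right_right)
qed

lemma br_uminus: "f \<in> F \<Longrightarrow> h \<in> F \<Longrightarrow> br (- f) h = - br f h"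
  using br_const_mult[of f h "-1"] by (simp add: const_uminus)

lemma br_self:
  assumes "f \<in> F"
  shows "br f f = 0"
proof -
  \<comment> \<open>The factor 2 is written as a real constant, so that it can be cancelled with
    \<open>const (1/2)\<close>.\<close>
  have "const 2 * br f f = br f f + br f f"
    by (metis const_1 const_add mult_2 one_add_one)
  also have "\<dots> = 0"
    using br_antisym[OF assms assms] by (metis add.right_inverse)
  finally have "const (1/2) * const 2 * br f f = 0"
    by (simp add: mult.assoc)
  then show ?thesis
    by (simp flip: const_mult)
qed

lemma br_sum:
  "(\<And>a. a \<in> A \<Longrightarrow> f a \<in> F) \<Longrightarrow> h \<in> F \<Longrightarrow> br (sum f A) h = (\<Sum>a\<in>A. br (f a) h)"
  by (induction A rule: infinite_finite_induct) (auto simp: br_add sum_in)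

lemma br_prod:
  "finite A \<Longrightarrow> (\<And>a. a \<in> A \<Longrightarrow> f a \<in> F) \<Longrightarrow> h \<in> F \<Longrightarrow>
    br (prod f A) h = (\<Sum>a\<in>A. br (f a) h * prod f (A - {a}))"
proof (induction A rule: finite_induct)
  case empty
  then show ?case by simp
next
  case (insert x A)
  have "br (f a) h * prod f (insert x A - {a}) = f x * (br (f a) h * prod f (A - {a}))"
    if "a \<in> A" for a
  proof -
    have "insert x A - {a} = insert x (A - {a})" "x \<notin> A - {a}"
      using insert.hyps that by auto
    then show ?thesis
      using insert.hyps by (simp add: mult_ac)
  qed
  then have "(\<Sum>a\<in>A. br (f a) h * prod f (insert x A - {a})) =
      f x * (\<Sum>a\<in>A. br (f a) h * prod f (A - {a}))"
    unfolding sum_distrib_left by (rule sum.cong[OF HOL.refl])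
  then have "(\<Sum>a\<in>A. br (f a) h * prod f (insert x A - {a})) = f x * br (prod f A) h"
    using insert.IH insert.prems by simp
  moreover have "insert x A - {x} = A"
    using insert.hyps by auto
  ultimately show ?case
    using insert by (simp add: br_mult prod_in)
qed

lemma det_in:
  assumes "X \<in> carrier_mat n n" "\<And>i j. i < n \<Longrightarrow> j < n \<Longrightarrow> X $$ (i, j) \<in> F"
  shows "det X \<in> F"
proof -
  have "signof p \<in> F" for p :: "nat \<Rightarrow> nat"
    by (simp add: sign_def)
  then show ?thesis
    unfolding det_def'[OF assms(1)] using assms(2)
    by (intro sum_in mult_in prod_in) (auto dest: permutes_in_image)
qed

text \<open>Row \<open>i\<close> of the sum is the determinant of the matrix in which row \<open>i\<close> is differentiated.\<close>

lemma br_det: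
  assumes X: "X \<in> carrier_mat n n" and XF: "\<And>i j. i < n \<Longrightarrow> j < n \<Longrightarrow> X $$ (i, j) \<in> F"
    and h: "h \<in> F"
  shows "br (det X) h = (\<Sum>i<n. \<Sum>j<n. cofactor X i j * br (X $$ (i, j)) h)"
proof -
  let ?P = "{p. p permutes {0..<n}}"
  let ?R = "\<lambda>i. mat n n (\<lambda>(a, b). if a = i then br (X $$ (i, b)) h else X $$ (a, b))"
  have pF: "X $$ (i, p i) \<in> F" if "p \<in> ?P" "i \<in> {0..<n}" for p i
    using that XF by (auto dest: permutes_in_image)
  have sF: "signof p \<in> F" for p :: "nat \<Rightarrow> nat"
    by (simp add: sign_def)
  have sgn: "br (signof p * f) h = signof p * br f h" if "f \<in> F" for p :: "nat \<Rightarrow> nat" and f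
    using that h by (simp add: sign_def br_uminus)
  have row: "det (?R i) = (\<Sum>j<n. cofactor X i j * br (X $$ (i, j)) h)" if i: "i < n" for i
  proof -
    have "det (?R i) = (\<Sum>j<n. ?R i $$ (i, j) * cofactor (?R i) i j)"
      by (rule laplace_expansion_row) (use i in auto)
    also have "\<dots> = (\<Sum>j<n. cofactor X i j * br (X $$ (i, j)) h)"
    proof (rule sum.cong[OF HOL.refl])
      fix j assume "j \<in> {..<n}"
      \<comment> \<open>Deleting row \<open>i\<close> removes the only row in which
        \<open>?R i\<close> and \<open>X\<close> differ, so the cofactors along this row
        agree.\<close>
      moreover have "mat_delete (?R i) i j = mat_delete X i j"
        using X i by (intro eq_matI) (auto simp: mat_delete_def)
      ultimately show "?R i $$ (i, j) * cofactor (?R i) i j = cofactor X i j * br (X $$ (i, j)) h"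
        using i by (simp add: cofactor_def mult.commute)
    qed
    finally show ?thesis .
  qed
  have "br (det X) h = (\<Sum>p\<in>?P. br (signof p * (\<Prod>i = 0..<n. X $$ (i, p i))) h)"
    unfolding det_def'[OF X] by (intro br_sum mult_in prod_in sF pF h) auto
  also have "\<dots> = (\<Sum>p\<in>?P. signof p *
      (\<Sum>i = 0..<n. br (X $$ (i, p i)) h * (\<Prod>a \<in> {0..<n} - {i}. X $$ (a, p a))))"
  proof (rule sum.cong[OF HOL.refl])
    fix p assume p: "p \<in> ?P"
    have "br (\<Prod>i = 0..<n. X $$ (i, p i)) h =
        (\<Sum>i = 0..<n. br (X $$ (i, p i)) h * (\<Prod>a \<in> {0..<n} - {i}. X $$ (a, p a)))"
      by (rule br_prod) (use pF[OF p] h in auto)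
    then show "br (signof p * (\<Prod>i = 0..<n. X $$ (i, p i))) h = signof p *
        (\<Sum>i = 0..<n. br (X $$ (i, p i)) h * (\<Prod>a \<in> {0..<n} - {i}. X $$ (a, p a)))"
      using sgn[OF prod_in, of "{0..<n}" "\<lambda>i. X $$ (i, p i)" p] pF[OF p] by simp
  qed
  \<comment> \<open>The differentiated factor is put back into the product as the entry of
    \<open>?R i\<close> in row \<open>i\<close>; summing over permutations then gives a determinant
    for each \<open>i\<close>.\<close>
  also have "\<dots> = (\<Sum>p\<in>?P. \<Sum>i = 0..<n. signof p * (\<Prod>a = 0..<n. ?R i $$ (a, p a)))"
  proof (rule sum.cong[OF HOL.refl], subst sum_distrib_left, rule sum.cong[OF HOL.refl])
    fix p i assume p: "p \<in> ?P" and i: "i \<in> {0..<n}"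
    have pn: "p a < n" if "a < n" for a
      using p that by (auto dest: permutes_in_image)
    have "(\<Prod>a = 0..<n. ?R i $$ (a, p a)) =
        ?R i $$ (i, p i) * (\<Prod>a \<in> {0..<n} - {i}. ?R i $$ (a, p a))"
      using i by (intro prod.remove) auto
    also have "\<dots> = br (X $$ (i, p i)) h * (\<Prod>a \<in> {0..<n} - {i}. X $$ (a, p a))"
      using i pn by (auto intro!: prod.cong)
    finally show "signof p * (br (X $$ (i, p i)) h * (\<Prod>a \<in> {0..<n} - {i}. X $$ (a, p a))) =
        signof p * (\<Prod>a = 0..<n. ?R i $$ (a, p a))"
      by simp
  qed
  also have "\<dots> = (\<Sum>i = 0..<n. det (?R i))"
    by (subst sum.swap) (simp add: det_def'[of "?R _" n])
  also have "\<dots> = (\<Sum>i<n. \<Sum>j<n. cofactor X i j * br (X $$ (i, j)) h)"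
    by (simp add: row atLeast0LessThan)
  finally show ?thesis .
qed

end

section \<open>The bracket of two minors\<close>

text \<open>When \<open>x\<close> and \<open>x'\<close> are the cofactors of two minors, the weight
  \<open>k\<close> depends on rows only and the inner sums are the minors with rows \<open>a\<close>
  and \<open>b\<close> exchanged between them.\<close>

lemma sum_row_exchange:
  fixes x x' k y :: "nat \<Rightarrow> nat \<Rightarrow> 'a::comm_ring_1"
  shows "(\<Sum>a\<in>A. \<Sum>c\<in>C. \<Sum>b\<in>B. \<Sum>d\<in>D. x a c * x' b d * (k a b * y a d * y b c)) =
    (\<Sum>a\<in>A. \<Sum>b\<in>B. k a b * (\<Sum>c\<in>C. x a c * y b c) * (\<Sum>d\<in>D. x' b d * y a d))"
proof (rule sum.cong[OF HOL.refl])
  fix a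
  show "(\<Sum>c\<in>C. \<Sum>b\<in>B. \<Sum>d\<in>D. x a c * x' b d * (k a b * y a d * y b c)) =
    (\<Sum>b\<in>B. k a b * (\<Sum>c\<in>C. x a c * y b c) * (\<Sum>d\<in>D. x' b d * y a d))"
    by (subst sum.swap) (simp add: sum_distrib_left sum_distrib_right mult_ac)
qed

text \<open>The same monomials, grouped by columns: the inner sums are now the minors with columns
  \<open>c\<close> and \<open>d\<close> exchanged.\<close>

lemma sum_column_exchange:
  fixes x x' k y :: "nat \<Rightarrow> nat \<Rightarrow> 'a::comm_ring_1"
  shows "(\<Sum>a\<in>A. \<Sum>c\<in>C. \<Sum>b\<in>B. \<Sum>d\<in>D. x a c * x' b d * (k c d * y a d * y b c)) =
    (\<Sum>c\<in>C. \<Sum>d\<in>D. k c d * (\<Sum>a\<in>A. x a c * y a d) * (\<Sum>b\<in>B. x' b d * y b c))"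
proof (subst sum.swap, rule sum.cong[OF HOL.refl])
  fix c
  have "(\<Sum>a\<in>A. \<Sum>b\<in>B. \<Sum>d\<in>D. x a c * x' b d * (k c d * y a d * y b c)) =
      (\<Sum>d\<in>D. \<Sum>a\<in>A. \<Sum>b\<in>B. x a c * x' b d * (k c d * y a d * y b c))"
    by (simp add: sum.swap[of _ D B]) (rule sum.swap)
  then show "(\<Sum>a\<in>A. \<Sum>b\<in>B. \<Sum>d\<in>D. x a c * x' b d * (k c d * y a d * y b c)) =
    (\<Sum>d\<in>D. k c d * (\<Sum>a\<in>A. x a c * y a d) * (\<Sum>b\<in>B. x' b d * y b c))"
    by (simp add: sum_distrib_left sum_distrib_right mult_ac)
qed

text \<open>Here every inner sum will be a Laplace expansion of an unchanged minor, so the double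
  sum becomes a scalar times the product of the two minors. The column version below serves the same
  purpose.\<close>

lemma sum_row_diagonal:
  fixes x x' k y :: "nat \<Rightarrow> nat \<Rightarrow> 'a::comm_ring_1"
  shows "(\<Sum>a\<in>A. \<Sum>c\<in>C. \<Sum>b\<in>B. \<Sum>d\<in>D. x a c * x' b d * (k a b * y a c * y b d)) =
    (\<Sum>a\<in>A. \<Sum>b\<in>B. k a b * (\<Sum>c\<in>C. x a c * y a c) * (\<Sum>d\<in>D. x' b d * y b d))"
proof (rule sum.cong[OF HOL.refl])
  fix a
  show "(\<Sum>c\<in>C. \<Sum>b\<in>B. \<Sum>d\<in>D. x a c * x' b d * (k a b * y a c * y b d)) =
    (\<Sum>b\<in>B. k a b * (\<Sum>c\<in>C. x a c * y a c) * (\<Sum>d\<in>D. x' b d * y b d))"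
    by (subst sum.swap) (simp add: sum_distrib_left sum_distrib_right mult_ac)
qed

lemma sum_column_diagonal:
  fixes x x' k y :: "nat \<Rightarrow> nat \<Rightarrow> 'a::comm_ring_1"
  shows "(\<Sum>a\<in>A. \<Sum>c\<in>C. \<Sum>b\<in>B. \<Sum>d\<in>D. x a c * x' b d * (k c d * y a c * y b d)) =
    (\<Sum>c\<in>C. \<Sum>d\<in>D. k c d * (\<Sum>a\<in>A. x a c * y a c) * (\<Sum>b\<in>B. x' b d * y b d))"
proof (subst sum.swap, rule sum.cong[OF HOL.refl])
  fix c
  have "(\<Sum>a\<in>A. \<Sum>b\<in>B. \<Sum>d\<in>D. x a c * x' b d * (k c d * y a c * y b d)) =
      (\<Sum>d\<in>D. \<Sum>a\<in>A. \<Sum>b\<in>B. x a c * x' b d * (k c d * y a c * y b d))"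
    by (simp add: sum.swap[of _ D B]) (rule sum.swap)
  then show "(\<Sum>a\<in>A. \<Sum>b\<in>B. \<Sum>d\<in>D. x a c * x' b d * (k c d * y a c * y b d)) =
    (\<Sum>d\<in>D. k c d * (\<Sum>a\<in>A. x a c * y a c) * (\<Sum>b\<in>B. x' b d * y b d))"
    by (simp add: sum_distrib_left sum_distrib_right mult_ac)
qed

definition sgn_diff :: "nat \<Rightarrow> nat \<Rightarrow> real" where
  "sgn_diff a b = sgn (real b - real a)"

text \<open>
  \<open>P a b\<close> is the minor \<open>f\<close> with row (or column) \<open>a\<close> replaced by \<open>b\<close>. A product \<open>P a b * P' b a\<close>
  with \<open>a \<noteq> b\<close> vanishes unless \<open>a \<in> A - A'\<close> and \<open>b \<in> A' - A\<close>.
\<close>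

lemma signed_exchange_sum:
  fixes P P' :: "nat \<Rightarrow> nat \<Rightarrow> ratfun"
  assumes "finite A" "finite A'"
    and P: "\<And>a b. a \<in> A \<Longrightarrow> b \<in> A \<Longrightarrow> P a b = (if a = b then f else 0)"
    and P': "\<And>a b. a \<in> A' \<Longrightarrow> b \<in> A' \<Longrightarrow> P' a b = (if a = b then g else 0)"
    and sgn: "\<And>a b. a \<in> A - A' \<Longrightarrow> b \<in> A' - A \<Longrightarrow> sgn_diff a b = \<epsilon>"
  shows "(\<Sum>a\<in>A. \<Sum>b\<in>A'. const (\<kappa> * sgn_diff a b) * P a b * P' b a) =
    const (\<kappa> * \<epsilon>) * ((\<Sum>a\<in>A. \<Sum>b\<in>A'. P a b * P' b a) - const (real (card (A \<inter> A'))) * f * g)"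
proof -
  \<comment> \<open>On the diagonal \<open>sgn_diff\<close> is 0 although the product is
    \<open>f * g\<close>; subtracting these terms leads to the count of
    \<open>A \<inter> A'\<close>.\<close>
  have "const (\<kappa> * sgn_diff a b) * P a b * P' b a =
      const (\<kappa> * \<epsilon>) * (P a b * P' b a - (if a = b then f * g else 0))"
    if "a \<in> A" "b \<in> A'" for a b
  proof -
    consider "a = b" | "a \<noteq> b" "b \<in> A" | "a \<noteq> b" "a \<in> A'" | "a \<in> A - A'" "b \<in> A' - A"
      using \<open>a \<in> A\<close> \<open>b \<in> A'\<close> by blast
    then show ?thesis
    proof cases
      case 1
      then show ?thesis using that by (simp add: P P' sgn_diff_def)
    next
      case 4
      then have "a \<noteq> b" by blast
      with 4 show ?thesis by (simp add: sgn)
    qed (use that in \<open>simp_all add: P P'\<close>)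
  qed
  then have "(\<Sum>a\<in>A. \<Sum>b\<in>A'. const (\<kappa> * sgn_diff a b) * P a b * P' b a) =
      const (\<kappa> * \<epsilon>) * ((\<Sum>a\<in>A. \<Sum>b\<in>A'. P a b * P' b a) - (\<Sum>a\<in>A. \<Sum>b\<in>A'. if a = b then f * g else 0))"
    by (simp add: sum_distrib_left sum_subtractf right_diff_distrib)
  also have "(\<Sum>a\<in>A. \<Sum>b\<in>A'. if a = b then f * g else 0) = (\<Sum>a\<in>A. if a \<in> A' then f * g else 0)"
    using assms(2) by simp
  also have "\<dots> = const (real (card (A \<inter> A'))) * f * g"
    using assms(1) by (simp add: sum.If_cases const_of_nat Int_def)
  finally show ?thesis .
qed

context poisson_subfield
begin

text \<open>\<open>cof\<close> are the cofactors and \<open>f\<close> is the determinant of the submatrix of \<open>y\<close> on \<open>A \<times> C\<close>.\<close>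

definition is_minor ::
    "(nat \<Rightarrow> nat \<Rightarrow> ratfun) \<Rightarrow> nat set \<Rightarrow> nat set \<Rightarrow> (nat \<Rightarrow> nat \<Rightarrow> ratfun) \<Rightarrow> ratfun \<Rightarrow> bool" where
  "is_minor y A C cof f \<longleftrightarrow>
     finite A \<and> finite C \<and> f \<in> F \<and> (\<forall>a\<in>A. \<forall>c\<in>C. y a c \<in> F) \<and>
     (\<forall>a\<in>A. \<forall>b\<in>A. (\<Sum>c\<in>C. cof a c * y b c) = (if a = b then f else 0)) \<and>
     (\<forall>c\<in>C. \<forall>d\<in>C. (\<Sum>a\<in>A. cof a c * y a d) = (if c = d then f else 0)) \<and>
     (\<forall>h\<in>F. br f h = (\<Sum>a\<in>A. \<Sum>c\<in>C. cof a c * br (y a c) h))"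

text \<open>The same \<open>\<epsilon>\<close> governs rows and columns. Both signed exchange sums
  are therefore the same multiple of an unsigned sum, up to diagonal terms, and enter with opposite
  signs.\<close>

lemma br_minors:
  assumes f: "is_minor y A C cof f" and g: "is_minor y A' C' cof' g"
    and y: "\<And>a b c d. a \<in> A \<Longrightarrow> c \<in> C \<Longrightarrow> b \<in> A' \<Longrightarrow> d \<in> C' \<Longrightarrow>
      br (y a c) (y b d) =
        const (\<kappa> * (sgn_diff a b - sgn_diff c d)) * y a d * y b c -
        const (\<mu> * (sgn_diff a b + sgn_diff c d)) * y a c * y b d"
    and rows: "\<And>a b. a \<in> A - A' \<Longrightarrow> b \<in> A' - A \<Longrightarrow> sgn_diff a b = \<epsilon>"
    and columns: "\<And>c d. c \<in> C - C' \<Longrightarrow> d \<in> C' - C \<Longrightarrow> sgn_diff c d = \<epsilon>"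
  shows "br f g =
    const (\<kappa> * \<epsilon> * (real (card (C \<inter> C')) - real (card (A \<inter> A'))) -
      \<mu> * ((\<Sum>a\<in>A. \<Sum>b\<in>A'. sgn_diff a b) + (\<Sum>c\<in>C. \<Sum>d\<in>C'. sgn_diff c d))) * f * g"
proof -
  note f' = f[unfolded is_minor_def] and g' = g[unfolded is_minor_def]
  let ?P = "\<lambda>a b. \<Sum>c\<in>C. cof a c * y b c" and ?P' = "\<lambda>b a. \<Sum>d\<in>C'. cof' b d * y a d"
  let ?Q = "\<lambda>c d. \<Sum>a\<in>A. cof a c * y a d" and ?Q' = "\<lambda>d c. \<Sum>b\<in>A'. cof' b d * y b c"
  have "br f g = (\<Sum>a\<in>A. \<Sum>c\<in>C. cof a c * br (y a c) g)"
    using f' g' by blast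
  also have "\<dots> = (\<Sum>a\<in>A. \<Sum>c\<in>C. cof a c * (\<Sum>b\<in>A'. \<Sum>d\<in>C'. cof' b d * br (y a c) (y b d)))"
  proof (intro sum.cong[OF HOL.refl])
    fix a c assume ac: "a \<in> A" "c \<in> C"
    then have yF: "y a c \<in> F" using f' by blast
    \<comment> \<open>\<open>is_minor\<close> expands the first argument only; antisymmetry before
      and after the expansion carries it over to the second.\<close>
    have "br (y a c) g = - br g (y a c)"
      using yF g' by (intro br_antisym) auto
    also have "br g (y a c) = (\<Sum>b\<in>A'. \<Sum>d\<in>C'. cof' b d * br (y b d) (y a c))"
      using g' yF by blast
    also have "\<dots> = (\<Sum>b\<in>A'. \<Sum>d\<in>C'. - (cof' b d * br (y a c) (y b d)))"
    proof (intro sum.cong[OF HOL.refl])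
      fix b d assume "b \<in> A'" "d \<in> C'"
      then have "br (y b d) (y a c) = - br (y a c) (y b d)"
        using yF g' by (intro br_antisym) auto
      then show "cof' b d * br (y b d) (y a c) = - (cof' b d * br (y a c) (y b d))"
        by simp
    qed
    finally show "cof a c * br (y a c) g =
        cof a c * (\<Sum>b\<in>A'. \<Sum>d\<in>C'. cof' b d * br (y a c) (y b d))"
      by (simp add: sum_negf)
  qed
  also have "\<dots> = (\<Sum>a\<in>A. \<Sum>c\<in>C. \<Sum>b\<in>A'. \<Sum>d\<in>C'.
        cof a c * cof' b d * (const (\<kappa> * sgn_diff a b) * y a d * y b c)
      - cof a c * cof' b d * (const (\<kappa> * sgn_diff c d) * y a d * y b c)
      - cof a c * cof' b d * (const (\<mu> * sgn_diff a b) * y a c * y b d)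
      - cof a c * cof' b d * (const (\<mu> * sgn_diff c d) * y a c * y b d))"
    by (simp add: y sum_distrib_left const_diff const_add algebra_simps cong: sum.cong)
  also have "\<dots> =
      (\<Sum>a\<in>A. \<Sum>b\<in>A'. const (\<kappa> * sgn_diff a b) * ?P a b * ?P' b a)
    - (\<Sum>c\<in>C. \<Sum>d\<in>C'. const (\<kappa> * sgn_diff c d) * ?Q c d * ?Q' d c)
    - (\<Sum>a\<in>A. \<Sum>b\<in>A'. const (\<mu> * sgn_diff a b) * ?P a a * ?P' b b)
    - (\<Sum>c\<in>C. \<Sum>d\<in>C'. const (\<mu> * sgn_diff c d) * ?Q c c * ?Q' d d)"
    unfolding sum_subtractf sum_row_exchange sum_column_exchange
      sum_row_diagonal sum_column_diagonal ..
  also have "(\<Sum>a\<in>A. \<Sum>b\<in>A'. const (\<kappa> * sgn_diff a b) * ?P a b * ?P' b a) =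
    const (\<kappa> * \<epsilon>) * ((\<Sum>a\<in>A. \<Sum>b\<in>A'. ?P a b * ?P' b a) - const (real (card (A \<inter> A'))) * f * g)"
    by (rule signed_exchange_sum) (use f' g' rows in auto)
  also have "(\<Sum>c\<in>C. \<Sum>d\<in>C'. const (\<kappa> * sgn_diff c d) * ?Q c d * ?Q' d c) =
    const (\<kappa> * \<epsilon>) * ((\<Sum>c\<in>C. \<Sum>d\<in>C'. ?Q c d * ?Q' d c) - const (real (card (C \<inter> C'))) * f * g)"
    by (rule signed_exchange_sum) (use f' g' columns in auto)
  \<comment> \<open>Both sides sum all terms containing \<open>y a d * y b c\<close> with weight 1,
    grouped by rows on the left and by columns on the right.\<close>
  also have "(\<Sum>a\<in>A. \<Sum>b\<in>A'. ?P a b * ?P' b a) = (\<Sum>c\<in>C. \<Sum>d\<in>C'. ?Q c d * ?Q' d c)"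
    using sum_row_exchange[of cof cof' "\<lambda>_ _. 1" y C' A' C A]
      sum_column_exchange[of cof cof' "\<lambda>_ _. 1" y C' A' C A] by simp
  also have "(\<Sum>a\<in>A. \<Sum>b\<in>A'. const (\<mu> * sgn_diff a b) * ?P a a * ?P' b b) =
      const (\<mu> * (\<Sum>a\<in>A. \<Sum>b\<in>A'. sgn_diff a b)) * f * g"
    using f' g' by (simp add: const_sum const_mult sum_distrib_left sum_distrib_right)
  also have "(\<Sum>c\<in>C. \<Sum>d\<in>C'. const (\<mu> * sgn_diff c d) * ?Q c c * ?Q' d d) =
      const (\<mu> * (\<Sum>c\<in>C. \<Sum>d\<in>C'. sgn_diff c d)) * f * g"
    using f' g' by (simp add: const_sum const_mult sum_distrib_left sum_distrib_right)
  finally show ?thesis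
    by (simp add: const_mult const_diff const_add algebra_simps)
qed

text \<open>The two orthogonality relations are the products of the matrix with its adjugate in
  either order, and the last clause is \<open>br_det\<close>. The bijections \<open>r\<close> and
  \<open>c\<close> transport all of this from positions to row and column labels.\<close>

lemma is_minor_det:
  assumes A: "finite A" and r: "bij_betw r {..<n} A" and c: "bij_betw c {..<n} C"
    and y: "\<And>a b. a \<in> A \<Longrightarrow> b \<in> C \<Longrightarrow> y a b \<in> F"
  shows "\<exists>cof. is_minor y A C cof (det (mat n n (\<lambda>(i, j). y (r i) (c j))))"
proof -
  let ?X = "mat n n (\<lambda>(i, j). y (r i) (c j))"
  let ?r = "the_inv_into {..<n} r" and ?c = "the_inv_into {..<n} c"
  let ?cof = "\<lambda>a b. cofactor ?X (?r a) (?c b)"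
  have X: "?X \<in> carrier_mat n n" by simp
  have ri: "r i \<in> A" "?r (r i) = i" and ci: "c i \<in> C" "?c (c i) = i" if "i < n" for i
    using r c that by (auto simp: bij_betw_def the_inv_into_f_f)
  have XF: "?X $$ (i, j) \<in> F" if "i < n" "j < n" for i j
    using that y ri ci by simp
  have sumA: "sum h A = (\<Sum>i<n. h (r i))" and sumC: "sum h C = (\<Sum>i<n. h (c i))"
    for h :: "nat \<Rightarrow> ratfun"
    using sum.reindex_bij_betw[OF r, of h] sum.reindex_bij_betw[OF c, of h] by simp_all
  have exA: "\<exists>i<n. a = r i" if "a \<in> A" for a
    using r that by (auto simp: bij_betw_def)
  have exC: "\<exists>i<n. a = c i" if "a \<in> C" for a
    using c that by (auto simp: bij_betw_def)
  have r_eq: "r i = r j \<longleftrightarrow> i = j" and c_eq: "c i = c j \<longleftrightarrow> i = j" if "i < n" "j < n" for i j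
    using that ri ci by metis+
  have row: "(\<Sum>j<n. cofactor ?X i j * y (r i') (c j)) = (if i = i' then det ?X else 0)"
    if "i < n" "i' < n" for i i'
  proof -
    have "(?X * adj_mat ?X) $$ (i', i) = (\<Sum>j<n. y (r i') (c j) * cofactor ?X i j)"
      using that by (simp add: adj_mat_def scalar_prod_def atLeast0LessThan)
    then show ?thesis
      using adj_mat(2)[OF X] that by (cases "i = i'") (simp_all add: mult.commute)
  qed
  have column: "(\<Sum>i<n. cofactor ?X i j * y (r i) (c j')) = (if j = j' then det ?X else 0)"
    if "j < n" "j' < n" for j j'
  proof -
    have "(adj_mat ?X * ?X) $$ (j, j') = (\<Sum>i<n. cofactor ?X i j * y (r i) (c j'))"
      using that by (simp add: adj_mat_def scalar_prod_def atLeast0LessThan)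
    then show ?thesis
      using adj_mat(3)[OF X] that by (cases "j = j'") simp_all
  qed
  have "is_minor y A C ?cof (det ?X)"
    unfolding is_minor_def
  proof (intro conjI ballI)
    show "finite C" using c bij_betw_finite by blast
    show "det ?X \<in> F" using det_in[OF X XF] by simp
    show "(\<Sum>c\<in>C. ?cof a c * y b c) = (if a = b then det ?X else 0)" if "a \<in> A" "b \<in> A" for a b
      using exA[OF that(1)] exA[OF that(2)] by (auto simp: sumC ri ci row r_eq)
    show "(\<Sum>a\<in>A. ?cof a b * y a d) = (if b = d then det ?X else 0)" if "b \<in> C" "d \<in> C" for b d
      using exC[OF that(1)] exC[OF that(2)] by (auto simp: sumA ri ci column c_eq)
    show "br (det ?X) h = (\<Sum>a\<in>A. \<Sum>c\<in>C. ?cof a c * br (y a c) h)" if "h \<in> F" for h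
      using br_det[OF X XF that] by (simp add: sumA sumC ri ci)
  qed (use A y in auto)
  then show ?thesis by blast
qed

end

section \<open>Mutation of log-canonical seeds\<close>

text \<open>This form of the correction separates a multiple of row \<open>l\<close>, whose product
  with \<open>\<omega>\<close> is known, from the positive part of row \<open>l\<close>, whose
  product with \<open>\<omega>\<close> is \<open>exchange_weight\<close>.\<close>

lemma exchange_mat_eq:
  assumes "i \<noteq> l" "j \<noteq> l"
  shows "exchange_mat S l i j =
    exch S i j + max (- exch S i l) 0 * exch S l j + exch S i l * max (exch S l j) 0"
proof -
  have "(\<bar>x\<bar> * y + x * \<bar>y\<bar>) div 2 = max (- x) 0 * y + x * max y 0" for x y :: int
    by (cases "0 \<le> x"; cases "0 \<le> y") (auto simp: max_def)
  then show ?thesis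
    using assms by (simp add: exchange_mat_def Let_def)
qed

lemma exchange_mat_pivot: "i = l \<or> j = l \<Longrightarrow> exchange_mat S l i j = - exch S i j"
  by (auto simp: exchange_mat_def Let_def)

lemma all_ix_adjacent [simp]: "all_ix (adjacent_seed S l) = all_ix S"
  by (simp add: all_ix_def adjacent_seed_def)

lemma cluster_ix_adjacent [simp]: "cluster_ix (adjacent_seed S l) = cluster_ix S"
  by (simp add: adjacent_seed_def)

lemma var_adjacent: "var (adjacent_seed S l) = (var S)(l := exchange_var S l)"
  by (simp add: adjacent_seed_def)

lemma exch_adjacent: "exch (adjacent_seed S l) = exchange_mat S l"
  by (simp add: adjacent_seed_def)

text \<open>The coefficient with which the monomial of positive exponents in the exchange relation
  brackets with variable \<open>c\<close>. Dividing by the old variable \<open>l\<close> explains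
  the subtraction in \<open>mutated_form\<close>.\<close>

definition exchange_weight :: "('v, 'f) seed \<Rightarrow> ('v \<Rightarrow> 'v \<Rightarrow> real) \<Rightarrow> 'v \<Rightarrow> 'v \<Rightarrow> real" where
  "exchange_weight S \<omega> l c = (\<Sum>b\<in>all_ix S. real_of_int (max (exch S l b) 0) * \<omega> b c)"

definition mutated_form :: "('v, 'f) seed \<Rightarrow> ('v \<Rightarrow> 'v \<Rightarrow> real) \<Rightarrow> 'v \<Rightarrow> 'v \<Rightarrow> 'v \<Rightarrow> real" where
  "mutated_form S \<omega> l i j =
     (if i = l \<and> j = l then 0
      else if i = l then exchange_weight S \<omega> l j - \<omega> l j
      else if j = l then \<omega> l i - exchange_weight S \<omega> l i
      else \<omega> i j)"

text \<open>The condition that the exchange matrix times \<open>\<omega>\<close> is \<open>(d \<cdot> \<one> 0)\<close>.\<close>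

definition compatible_form :: "('v, 'f) seed \<Rightarrow> real \<Rightarrow> ('v \<Rightarrow> 'v \<Rightarrow> real) \<Rightarrow> bool" where
  "compatible_form S d \<omega> \<longleftrightarrow>
     finite (all_ix S) \<and>
     (\<forall>i\<in>all_ix S. \<forall>j\<in>all_ix S. \<omega> i j = - \<omega> j i) \<and>
     (\<forall>i\<in>cluster_ix S. \<forall>j\<in>cluster_ix S. exch S i j = - exch S j i) \<and>
     (\<forall>a\<in>cluster_ix S. \<forall>c\<in>all_ix S.
        (\<Sum>b\<in>all_ix S. real_of_int (exch S a b) * \<omega> b c) = (if a = c then d else 0))"

text \<open>Linear algebra only. For a column other than \<open>l\<close> the form changes in row
  \<open>l\<close> alone, which compensates the positive part added to row \<open>a\<close> of the
  matrix. Column \<open>l\<close> of the new form is a combination of old columns, so it reduces to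
  the same computation.\<close>

lemma compatible_form_adjacent:
  assumes comp: "compatible_form S d \<omega>" and l: "l \<in> cluster_ix S"
  shows "compatible_form (adjacent_seed S l) d (mutated_form S \<omega> l)"
proof -
  let ?N = "all_ix S" and ?K = "cluster_ix S" and ?w = "exchange_weight S \<omega> l"
  let ?\<omega>' = "mutated_form S \<omega> l"
  let ?B = "\<lambda>a b. real_of_int (exch S a b)" and ?B' = "\<lambda>a b. real_of_int (exchange_mat S l a b)"
  have fin: "finite ?N"
    using comp unfolding compatible_form_def by blast
  have anti: "\<omega> i j = - \<omega> j i" if "i \<in> ?N" "j \<in> ?N" for i j
    using comp that unfolding compatible_form_def by blast
  have skew: "exch S i j = - exch S j i" if "i \<in> ?K" "j \<in> ?K" for i j
    using comp that unfolding compatible_form_def by blast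
  have prod: "(\<Sum>b\<in>?N. ?B a b * \<omega> b c) = (if a = c then d else 0)" if "a \<in> ?K" "c \<in> ?N" for a c
    using comp that unfolding compatible_form_def by blast
  have KN: "?K \<subseteq> ?N" and lN: "l \<in> ?N" using l by (auto simp: all_ix_def)
  have Bll: "exch S l l = 0" using skew[OF l l] by simp
  have \<omega>ll: "\<omega> l l = 0" using anti[OF lN lN] by simp
  have drop_l: "sum h (?N - {l}) = sum h ?N - h l" for h :: "'a \<Rightarrow> real"
    using fin lN by (simp add: sum_diff1)
  have anti': "?\<omega>' i j = - ?\<omega>' j i" if "i \<in> ?N" "j \<in> ?N" for i j
    using anti[OF that] by (auto simp: mutated_form_def)
  have skew': "exchange_mat S l i j = - exchange_mat S l j i" if ij: "i \<in> ?K" "j \<in> ?K" for i j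
  proof (cases "i = l \<or> j = l")
    case True
    then show ?thesis using skew[OF ij] by (auto simp: exchange_mat_pivot)
  next
    case False
    \<comment> \<open>With \<open>x\<close> the entry at \<open>(i, l)\<close> and \<open>y\<close>
      the entry at \<open>(l, j)\<close>, transposition replaces \<open>(x, y)\<close> by
      \<open>(-y, -x)\<close>.\<close>
    have "max (- x) 0 * y + x * max y 0 = - (max y 0 * - x + - y * max (- x) 0)" for x y :: int
      by simp
    then show ?thesis
      using False skew[OF ij] skew[OF ij(1) l] skew[OF ij(2) l]
      by (simp add: exchange_mat_eq mult.commute)
  qed
  \<comment> \<open>The positive exchange monomial has weight 0 with itself, since an antisymmetric
    form vanishes on the diagonal.\<close>
  have sum_w: "(\<Sum>e\<in>?N. real_of_int (max (exch S l e) 0) * ?w e) = 0"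
  proof -
    let ?p = "\<lambda>e. real_of_int (max (exch S l e) 0)"
    let ?s = "\<Sum>e\<in>?N. \<Sum>b\<in>?N. ?p e * ?p b * \<omega> b e"
    have "?s = (\<Sum>e\<in>?N. \<Sum>b\<in>?N. ?p b * ?p e * \<omega> e b)"
      by (rule sum.swap)
    also have "\<dots> = (\<Sum>e\<in>?N. \<Sum>b\<in>?N. - (?p e * ?p b * \<omega> b e))"
    proof (intro sum.cong[OF HOL.refl])
      fix e b assume "e \<in> ?N" "b \<in> ?N"
      then show "?p b * ?p e * \<omega> e b = - (?p e * ?p b * \<omega> b e)"
        using anti[of e b] by simp
    qed
    also have "\<dots> = - ?s" by (simp add: sum_negf)
    finally have "?s = 0" by simp
    then show ?thesis
      by (simp add: exchange_weight_def sum_distrib_left mult.assoc)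
  qed
  have w_anti: "(\<Sum>e\<in>?N. real_of_int (max (exch S l e) 0) * \<omega> c e) = - ?w c" if "c \<in> ?N" for c
    unfolding exchange_weight_def sum_negf[symmetric]
    by (intro sum.cong[OF HOL.refl]) (simp add: anti[OF that])
  \<comment> \<open>Column \<open>l\<close> of the matrix is left out: there
    \<open>exchange_mat_eq\<close> does not apply, and row \<open>l\<close> of the form
    changes.\<close>
  have part: "(\<Sum>b\<in>?N - {l}. ?B' a b * \<omega> b c) = (if a = c then d else 0) - ?B a l * \<omega> l c +
      (if c = l then real_of_int (max (- exch S a l) 0) * d else 0) + ?B a l * ?w c"
    if a: "a \<in> ?K" "a \<noteq> l" and c: "c \<in> ?N" for a c
  proof -
    have "(\<Sum>b\<in>?N - {l}. ?B' a b * \<omega> b c) =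
      (\<Sum>b\<in>?N - {l}. ?B a b * \<omega> b c + real_of_int (max (- exch S a l) 0) * (?B l b * \<omega> b c)
        + ?B a l * (real_of_int (max (exch S l b) 0) * \<omega> b c))"
      using a by (intro sum.cong[OF HOL.refl]) (simp add: exchange_mat_eq algebra_simps)
    also have "\<dots> = (\<Sum>b\<in>?N - {l}. ?B a b * \<omega> b c) +
        real_of_int (max (- exch S a l) 0) * (\<Sum>b\<in>?N - {l}. ?B l b * \<omega> b c) +
        ?B a l * (\<Sum>b\<in>?N - {l}. real_of_int (max (exch S l b) 0) * \<omega> b c)"
      by (simp only: sum.distrib sum_distrib_left)
    also have "\<dots> = (if a = c then d else 0) - ?B a l * \<omega> l c +
      (if c = l then real_of_int (max (- exch S a l) 0) * d else 0) + ?B a l * ?w c"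
      using prod[OF a(1) c] prod[OF l c]
      by (auto simp: drop_l Bll exchange_weight_def)
    finally show ?thesis .
  qed
  have split_l: "(\<Sum>b\<in>?N. ?B' a b * ?\<omega>' b c) = (\<Sum>b\<in>?N - {l}. ?B' a b * ?\<omega>' b c) + ?B' a l * ?\<omega>' l c"
    for a c using drop_l[of "\<lambda>b. ?B' a b * ?\<omega>' b c"] by simp
  have w_ll: "?\<omega>' l l = 0" by (simp add: mutated_form_def)
  \<comment> \<open>Column \<open>l\<close> of the new form is expanded in columns of
    \<open>\<omega>\<close>, so that \<open>part\<close> applies to each of them.\<close>
  have off: "(\<Sum>b\<in>?N - {l}. ?B' a b * ?\<omega>' b l) =
      (\<Sum>e\<in>?N. real_of_int (max (exch S l e) 0) * (\<Sum>b\<in>?N - {l}. ?B' a b * \<omega> b e))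
      - (\<Sum>b\<in>?N - {l}. ?B' a b * \<omega> b l)" for a
  proof -
    have "(\<Sum>b\<in>?N - {l}. ?B' a b * ?\<omega>' b l) =
        (\<Sum>b\<in>?N - {l}. ?B' a b * (\<Sum>e\<in>?N. real_of_int (max (exch S l e) 0) * \<omega> b e) - ?B' a b * \<omega> b l)"
    proof (rule sum.cong[OF HOL.refl])
      fix b assume "b \<in> ?N - {l}"
      then show "?B' a b * ?\<omega>' b l =
          ?B' a b * (\<Sum>e\<in>?N. real_of_int (max (exch S l e) 0) * \<omega> b e) - ?B' a b * \<omega> b l"
        using w_anti[of b] anti[of l b] lN by (simp add: mutated_form_def algebra_simps)
    qed
    also have "(\<Sum>b\<in>?N - {l}. ?B' a b * (\<Sum>e\<in>?N. real_of_int (max (exch S l e) 0) * \<omega> b e) - ?B' a b * \<omega> b l)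
      = (\<Sum>b\<in>?N - {l}. \<Sum>e\<in>?N. real_of_int (max (exch S l e) 0) * (?B' a b * \<omega> b e))
        - (\<Sum>b\<in>?N - {l}. ?B' a b * \<omega> b l)"
      by (simp add: sum_subtractf sum_distrib_left mult_ac)
    finally show ?thesis
      by (simp add: sum.swap[of _ "?N" "?N - {l}"] sum_distrib_left)
  qed
  have prod': "(\<Sum>b\<in>?N. ?B' a b * ?\<omega>' b c) = (if a = c then d else 0)"
    if a: "a \<in> ?K" and c: "c \<in> ?N" for a c
  proof -
    consider "a \<noteq> l" "c \<noteq> l" | "a \<noteq> l" "c = l" | "a = l" "c \<noteq> l" | "a = l" "c = l" by blast
    then show ?thesis
    proof cases
      case 1
      have "(\<Sum>b\<in>?N - {l}. ?B' a b * ?\<omega>' b c) = (\<Sum>b\<in>?N - {l}. ?B' a b * \<omega> b c)"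
        using 1 by (intro sum.cong[OF HOL.refl]) (simp add: mutated_form_def)
      moreover have "?B' a l = - ?B a l" "?\<omega>' l c = ?w c - \<omega> l c"
        using 1 by (simp_all add: exchange_mat_pivot mutated_form_def)
      ultimately have "(\<Sum>b\<in>?N. ?B' a b * ?\<omega>' b c) =
          (\<Sum>b\<in>?N - {l}. ?B' a b * \<omega> b c) - ?B a l * (?w c - \<omega> l c)"
        by (simp only: split_l)
      then show ?thesis
        using 1 by (simp only: part[OF a 1(1) c]) (simp add: right_diff_distrib)
    next
      case 2
      let ?p = "\<lambda>e. real_of_int (max (exch S l e) 0)" and ?n = "real_of_int (max (- exch S a l) 0)"
      have "(\<Sum>e\<in>?N. ?p e * (\<Sum>b\<in>?N - {l}. ?B' a b * \<omega> b e)) =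
          (\<Sum>e\<in>?N. (if a = e then ?p a * d else 0) - ?B a l * (?p e * \<omega> l e)
            + (if e = l then ?p l * ?n * d else 0) + ?B a l * (?p e * ?w e))"
      proof (rule sum.cong[OF HOL.refl])
        fix e assume "e \<in> ?N"
        then show "?p e * (\<Sum>b\<in>?N - {l}. ?B' a b * \<omega> b e) = (if a = e then ?p a * d else 0)
            - ?B a l * (?p e * \<omega> l e) + (if e = l then ?p l * ?n * d else 0) + ?B a l * (?p e * ?w e)"
          by (simp only: part[OF a 2(1)]) (auto simp: algebra_simps)
      qed
      also have "\<dots> = ?p a * d + ?B a l * ?w l"
        using a KN fin lN w_anti[OF lN] sum_w
        by (auto simp: sum.distrib sum_subtractf Bll simp flip: sum_distrib_left)
      finally have "(\<Sum>b\<in>?N - {l}. ?B' a b * ?\<omega>' b l) = ?p a * d - ?n * d"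
        using part[OF a 2(1) lN] 2 by (simp add: off \<omega>ll)
      \<comment> \<open>The first term comes from the column \<open>e = a\<close>, the second from
        the column \<open>l\<close> itself; skew-symmetry makes the two positive parts
        equal.\<close>
      also have "\<dots> = 0" using skew[OF a l] by simp
      finally show ?thesis
        unfolding 2(2) split_l w_ll using 2 by simp
    next
      case 3
      have "(\<Sum>b\<in>?N - {l}. ?B' a b * ?\<omega>' b c) = - (\<Sum>b\<in>?N - {l}. ?B l b * \<omega> b c)"
        unfolding sum_negf[symmetric]
        using 3 by (intro sum.cong[OF HOL.refl]) (simp add: mutated_form_def exchange_mat_pivot)
      moreover have "(\<Sum>b\<in>?N - {l}. ?B l b * \<omega> b c) = 0"
        using 3 prod[OF l c] by (simp add: drop_l Bll)
      ultimately show ?thesis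
        unfolding 3(1) split_l using 3 by (simp add: exchange_mat_pivot Bll)
    next
      case 4
      have row: "(\<Sum>b\<in>?N - {l}. ?B' l b * \<omega> b e) = - (if l = e then d else 0)" if "e \<in> ?N" for e
        using prod[OF l that] by (simp add: exchange_mat_pivot sum_negf drop_l Bll)
      have "(\<Sum>e\<in>?N. real_of_int (max (exch S l e) 0) * (\<Sum>b\<in>?N - {l}. ?B' l b * \<omega> b e)) = 0"
        by (rule sum.neutral) (auto simp: row Bll)
      then show ?thesis
        unfolding 4 split_l w_ll off using row[OF lN] by simp
    qed
  qed
  show ?thesis
    unfolding compatible_form_def all_ix_adjacent cluster_ix_adjacent exch_adjacent
    using fin anti' skew' prod' by blast
qed

section \<open>Log-canonical pairs under products, quotients and exchange\<close>

context poisson_subfield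
begin

definition log_canonical :: "real \<Rightarrow> ratfun \<Rightarrow> ratfun \<Rightarrow> bool" where
  "log_canonical w f g \<longleftrightarrow> f \<in> F \<and> g \<in> F \<and> br f g = const w * f * g"

lemma log_canonical_sym: "log_canonical w f g \<Longrightarrow> log_canonical (- w) g f"
  using br_antisym[of g f] by (auto simp: log_canonical_def const_uminus)

lemma log_canonical_1: "g \<in> F \<Longrightarrow> log_canonical 0 1 g"
  by (simp add: log_canonical_def)

lemma log_canonical_mult:
  "log_canonical v f h \<Longrightarrow> log_canonical w g h \<Longrightarrow> log_canonical (v + w) (f * g) h"
  by (auto simp: log_canonical_def br_mult const_add algebra_simps)

lemma log_canonical_power: "log_canonical w f h \<Longrightarrow> log_canonical (of_nat n * w) (f ^ n) h"
proof (induction n)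
  case 0
  then show ?case by (simp add: log_canonical_1 log_canonical_def)
next
  case (Suc n)
  then show ?case
    using log_canonical_mult[of w f h "of_nat n * w" "f ^ n"] by (simp add: algebra_simps)
qed

lemma log_canonical_prod:
  assumes "h \<in> F" "\<And>a. a \<in> A \<Longrightarrow> log_canonical (w a) (f a) h"
  shows "log_canonical (sum w A) (prod f A) h"
  using assms(2)
  by (induction A rule: infinite_finite_induct)
    (auto intro: log_canonical_mult log_canonical_1 assms(1))

lemma log_canonical_add:
  "log_canonical w f h \<Longrightarrow> log_canonical w g h \<Longrightarrow> log_canonical w (f + g) h"
  by (auto simp: log_canonical_def br_add algebra_simps)

lemma log_canonical_const_mult:
  "log_canonical w f g \<Longrightarrow> log_canonical w (const c * f) g"
  by (simp add: log_canonical_def br_const_mult mult.assoc mult.left_commute)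

text \<open>Apply the Leibniz rule to \<open>f * inverse f = 1\<close>. For \<open>f = 0\<close> the
  convention \<open>inverse 0 = 0\<close> makes both sides zero.\<close>

lemma log_canonical_inverse:
  assumes "log_canonical w f h"
  shows "log_canonical (- w) (inverse f) h"
proof (cases "f = 0")
  case True
  then show ?thesis using assms by (simp add: log_canonical_def)
next
  case False
  have f: "f \<in> F" "h \<in> F" "br f h = const w * f * h"
    using assms by (simp_all add: log_canonical_def)
  have "0 = br (f * inverse f) h"
    using False f by simp
  also have "\<dots> = f * br (inverse f) h + const w * h"
    using False f by (subst br_mult) (simp_all add: mult.assoc mult.left_commute[of _ "inverse _"])
  finally have "f * br (inverse f) h = - (const w * h)"
    by (simp add: eq_neg_iff_add_eq_0)
  also have "\<dots> = f * (- const w * inverse f * h)"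
    using False by simp
  finally have "br (inverse f) h = - const w * inverse f * h"
    using False by (simp only: mult_cancel_left simp_thms)
  then show ?thesis
    using False f by (simp add: log_canonical_def const_uminus)
qed

definition log_canonical_seed :: "('v, ratfun) seed \<Rightarrow> real \<Rightarrow> ('v \<Rightarrow> 'v \<Rightarrow> real) \<Rightarrow> bool" where
  "log_canonical_seed S d \<omega> \<longleftrightarrow> compatible_form S d \<omega> \<and>
     (\<forall>i\<in>all_ix S. \<forall>j\<in>all_ix S. log_canonical (\<omega> i j) (var S i) (var S j))"

text \<open>For \<open>c \<noteq> l\<close> row \<open>l\<close> of the exchange matrix times column
  \<open>c\<close> of \<open>\<omega>\<close> is 0, so both monomials of the exchange relation have
  the same coefficient with variable \<open>c\<close>. Their sum is then log-canonical with it, and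
  dividing by variable \<open>l\<close> subtracts \<open>\<omega> l c\<close>.\<close>

lemma log_canonical_exchange_var:
  assumes S: "log_canonical_seed S d \<omega>" and l: "l \<in> cluster_ix S"
    and c: "c \<in> all_ix S" "c \<noteq> l"
  shows "log_canonical (exchange_weight S \<omega> l c - \<omega> l c) (exchange_var S l) (var S c)"
proof -
  let ?N = "all_ix S" and ?b = "exch S l"
  have lc: "log_canonical (\<omega> i j) (var S i) (var S j)" if "i \<in> ?N" "j \<in> ?N" for i j
    using S that unfolding log_canonical_seed_def by blast
  have lN: "l \<in> ?N" using l by (simp add: all_ix_def)
  have cF: "var S c \<in> F" using lc[OF c(1) c(1)] by (simp add: log_canonical_def)
  have fin: "finite ?N" using S by (simp add: log_canonical_seed_def compatible_form_def)
  have "(\<Sum>b\<in>?N. real_of_int (?b b) * \<omega> b c) = (if l = c then d else 0)"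
    using S l c(1) unfolding log_canonical_seed_def compatible_form_def by blast
  then have "(\<Sum>b\<in>?N. real_of_int (?b b) * \<omega> b c) = 0"
    using c(2) by simp
  moreover have "real_of_int (?b b) * \<omega> b c =
      real_of_int (max (?b b) 0) * \<omega> b c - real_of_int (max (- ?b b) 0) * \<omega> b c" for b
    by (simp add: max_def)
  ultimately have "(\<Sum>b\<in>?N. real_of_int (max (?b b) 0) * \<omega> b c
      - real_of_int (max (- ?b b) 0) * \<omega> b c) = 0"
    by (simp only:)
  then have balance: "exchange_weight S \<omega> l c = (\<Sum>b\<in>?N. real_of_int (max (- ?b b) 0) * \<omega> b c)"
    by (simp add: exchange_weight_def sum_subtractf)
  \<comment> \<open>The values \<open>s = 1\<close> and \<open>s = -1\<close> give the two
    monomials.\<close>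
  have mono: "log_canonical (\<Sum>b\<in>?N. real_of_int (max (s * ?b b) 0) * \<omega> b c)
      (\<Prod>b\<in>{b\<in>?N. s * ?b b > 0}. var S b ^ nat (s * ?b b)) (var S c)" for s
  proof -
    have "(\<Sum>b\<in>?N. real_of_int (max (s * ?b b) 0) * \<omega> b c) =
        (\<Sum>b\<in>{b\<in>?N. s * ?b b > 0}. of_nat (nat (s * ?b b)) * \<omega> b c)"
      using fin by (intro sum.mono_neutral_cong_right) auto
    then show ?thesis
      using cF c by (simp only:) (intro log_canonical_prod log_canonical_power lc; simp)
  qed
  have "log_canonical (exchange_weight S \<omega> l c + - \<omega> l c)
     (((\<Prod>i\<in>{i\<in>?N. ?b i > 0}. var S i ^ nat (?b i)) +
       (\<Prod>i\<in>{i\<in>?N. ?b i < 0}. var S i ^ nat (- ?b i))) * inverse (var S l)) (var S c)"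
    using mono[of 1] mono[of "-1"] balance lN c
    by (intro log_canonical_mult log_canonical_add log_canonical_inverse lc)
      (simp_all add: exchange_weight_def)
  then show ?thesis
    by (simp add: exchange_var_def divide_inverse)
qed

lemma log_canonical_seed_adjacent:
  assumes S: "log_canonical_seed S d \<omega>" and l: "l \<in> cluster_ix S"
  shows "log_canonical_seed (adjacent_seed S l) d (mutated_form S \<omega> l)"
proof -
  let ?N = "all_ix S"
  have comp: "compatible_form S d \<omega>" using S by (simp add: log_canonical_seed_def)
  have lc: "log_canonical (\<omega> i j) (var S i) (var S j)" if "i \<in> ?N" "j \<in> ?N" for i j
    using S that unfolding log_canonical_seed_def by blast
  have lN: "l \<in> ?N" using l by (simp add: all_ix_def)
  have varF: "var S i \<in> F" if "i \<in> ?N" for i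
    using lc[OF that that] by (simp add: log_canonical_def)
  then have "exchange_var S l \<in> F"
    using lN by (auto simp: exchange_var_def divide_inverse intro!: mult_in add_in prod_in)
  then have self: "log_canonical 0 (exchange_var S l) (exchange_var S l)"
    by (simp add: log_canonical_def br_self)
  have "log_canonical (mutated_form S \<omega> l i j) (var (adjacent_seed S l) i) (var (adjacent_seed S l) j)"
    if "i \<in> ?N" "j \<in> ?N" for i j
    using that self lc[OF that] log_canonical_exchange_var[OF S l, of j]
      log_canonical_sym[OF log_canonical_exchange_var[OF S l, of i]]
    by (auto simp: mutated_form_def var_adjacent)
  then show ?thesis
    using compatible_form_adjacent[OF comp l] by (simp add: log_canonical_seed_def)
qed

text \<open>Along a sequence of mutations the form changes with the seed while \<open>d\<close>
  stays fixed.\<close>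

lemma log_canonical_seed_compatible:
  assumes "log_canonical_seed S d \<omega>"
  shows "compatible br S"
proof -
  have "\<exists>\<omega>. log_canonical_seed T d \<omega>" if "mutation_equivalent S T" for T
    using that
  proof induction
    case refl
    show ?case using assms by blast
  next
    case (step T l)
    then show ?case using log_canonical_seed_adjacent by metis
  qed
  then show ?thesis
    unfolding compatible_def log_canonical_seed_def log_canonical_def by blast
qed

end

section \<open>The form of the initial seed\<close>

text \<open>
  Both sets are empty for \<open>i = 0\<close> and for \<open>j = m + 1\<close>, so that
  the exchange relations of the initial seed take the same form at the boundary of the array.
\<close>

fun minor_rows :: "nat \<Rightarrow> nat \<times> nat \<Rightarrow> nat set" where
  "minor_rows m (i, j) = {Suc (i + j - Suc m)..i}"

fun minor_cols :: "nat \<Rightarrow> nat \<times> nat \<Rightarrow> nat set" where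
  "minor_cols m (i, j) = {j..min m (i + j - 1)}"

lemma finite_minor_rows [simp]: "finite (minor_rows m u)"
  by (cases u) simp

lemma finite_minor_cols [simp]: "finite (minor_cols m u)"
  by (cases u) simp

text \<open>The value is -1 if the interval of rows of the first minor, or that of its columns, ends
  and starts later than that of the second. The truncated difference \<open>i + j - Suc m\<close>
  counts the rows before the minor.\<close>

fun form_sign :: "nat \<Rightarrow> nat \<times> nat \<Rightarrow> nat \<times> nat \<Rightarrow> real" where
  "form_sign m (i, j) (i', j') =
     (if i > i' \<and> i + j - Suc m > i' + j' - Suc m \<or>
         min m (i + j - 1) > min m (i' + j' - 1) \<and> j > j' then -1 else 1)"

definition overlap :: "nat \<Rightarrow> nat \<times> nat \<Rightarrow> nat \<times> nat \<Rightarrow> real" where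
  "overlap m u v =
     real (card (minor_cols m u \<inter> minor_cols m v)) - real (card (minor_rows m u \<inter> minor_rows m v))"

definition sgn_sum :: "nat set \<Rightarrow> nat set \<Rightarrow> real" where
  "sgn_sum A B = (\<Sum>a\<in>A. \<Sum>b\<in>B. sgn_diff a b)"

text \<open>The coefficient delivered by \<open>br_minors\<close> with \<open>form_sign\<close> as
  \<open>\<epsilon>\<close>.\<close>

definition initial_form :: "nat \<Rightarrow> real \<Rightarrow> real \<Rightarrow> nat \<times> nat \<Rightarrow> nat \<times> nat \<Rightarrow> real" where
  "initial_form m \<kappa> \<mu> u v = \<kappa> * form_sign m u v * overlap m u v -
     \<mu> * (sgn_sum (minor_rows m u) (minor_rows m v) + sgn_sum (minor_cols m u) (minor_cols m v))"

text \<open>If neither of two intervals contains the other, one is shifted against the other, which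
  fixes the sign. Rows and columns cannot disagree: minors starting in row 1 have nested rows,
  minors ending in column \<open>m\<close> have nested columns, and in the mixed case any shift
  moves the minor ending in column \<open>m\<close> onwards.\<close>

lemma form_sign_rows:
  assumes "1 \<le> j" "j \<le> m" "1 \<le> j'" "j' \<le> m"
    and "a \<in> minor_rows m (i, j) - minor_rows m (i', j')"
    and "b \<in> minor_rows m (i', j') - minor_rows m (i, j)"
  shows "sgn_diff a b = form_sign m (i, j) (i', j')"
  using assms by (auto simp: sgn_diff_def sgn_if)

lemma form_sign_cols:
  assumes "1 \<le> i" "1 \<le> i'"  "1 \<le> j" "j \<le> m" "1 \<le> j'" "j' \<le> m"
    and "c \<in> minor_cols m (i, j) - minor_cols m (i', j')"
    and "d \<in> minor_cols m (i', j') - minor_cols m (i, j)"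
  shows "sgn_diff c d = form_sign m (i, j) (i', j')"
  using assms by (auto simp: sgn_diff_def sgn_if)

text \<open>The pairing of \<open>\<phi>\<close> with row \<open>(i, j)\<close> of the initial
  exchange matrix: heads of arrows leaving \<open>(i, j)\<close> count positively, tails of arrows
  entering it negatively.\<close>

definition hexagon :: "(nat \<times> nat \<Rightarrow> real) \<Rightarrow> nat \<Rightarrow> nat \<Rightarrow> real" where
  "hexagon \<phi> i j = \<phi> (i, j + 1) + \<phi> (i - 1, j) + \<phi> (i + 1, j - 1)
     - \<phi> (i, j - 1) - \<phi> (i + 1, j) - \<phi> (i - 1, j + 1)"

text \<open>The hexagon annihilates all functions of \<open>i\<close>, of \<open>j\<close>, and of \<open>i + j\<close>.\<close>

lemma hexagon_sum_rows:
  assumes "1 \<le> i" "2 \<le> j" "j \<le> m"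
  shows "hexagon (\<lambda>u. sum h (minor_rows m u)) i j = 0"
proof -
  let ?H = "\<lambda>x. sum h {1..x}"
  \<comment> \<open>A function of \<open>i\<close> minus a function of \<open>i + j\<close>. The
    bound includes column \<open>m + 1\<close>, which the hexagon reaches.\<close>
  have rows: "sum h (minor_rows m (x, y)) = ?H x - ?H (x + y - Suc m)" if "y \<le> Suc m" for x y
  proof -
    have "{1..x} = {1..x + y - Suc m} \<union> minor_rows m (x, y)"
      "{1..x + y - Suc m} \<inter> minor_rows m (x, y) = {}"
      using that by auto
    then show ?thesis by (simp add: sum.union_disjoint del: minor_rows.simps)
  qed
  obtain p q where "i = Suc p" "j = Suc q"
    using assms by (metis One_nat_def Suc_1 Suc_le_D)
  then show ?thesis
    using assms by (simp add: hexagon_def rows del: minor_rows.simps)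
qed

lemma hexagon_sum_cols:
  assumes "1 \<le> i" "2 \<le> j" "j \<le> m"
  shows "hexagon (\<lambda>u. sum h (minor_cols m u)) i j = 0"
proof -
  let ?H = "\<lambda>x. sum h {1..x}"
  \<comment> \<open>A function of \<open>i + j\<close> minus a function of \<open>j\<close>.\<close>
  have cols: "sum h (minor_cols m (x, y)) = ?H (min m (x + y - 1)) - ?H (y - 1)"
    if "1 \<le> y" "y \<le> Suc m" for x y
  proof -
    have "{1..min m (x + y - 1)} = {1..y - 1} \<union> minor_cols m (x, y)"
      "{1..y - 1} \<inter> minor_cols m (x, y) = {}"
      using that by auto
    then show ?thesis by (simp add: sum.union_disjoint del: minor_cols.simps)
  qed
  obtain p q where "i = Suc p" "j = Suc (Suc q)"
    using assms by (metis One_nat_def Suc_1 Suc_le_D Suc_le_mono)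
  then show ?thesis
    using assms by (simp add: hexagon_def cols del: minor_cols.simps)
qed

text \<open>For fixed \<open>v\<close> the overlap is a sum of indicators over the columns of
  \<open>u\<close> minus one over its rows.\<close>

lemma hexagon_overlap:
  assumes "1 \<le> i" "2 \<le> j" "j \<le> m"
  shows "hexagon (\<lambda>u. overlap m u v) i j = 0"
proof -
  have "real (card (X \<inter> Y)) = (\<Sum>x\<in>X. of_bool (x \<in> Y))" if "finite X" for X Y :: "nat set"
    using that by (simp add: Int_def)
  then have eq: "overlap m u v = (\<Sum>c\<in>minor_cols m u. of_bool (c \<in> minor_cols m v)) -
      (\<Sum>a\<in>minor_rows m u. of_bool (a \<in> minor_rows m v))" for u
    unfolding overlap_def by simp
  show ?thesis
    using hexagon_sum_rows[OF assms, of "\<lambda>a. of_bool (a \<in> minor_rows m v)"]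
      hexagon_sum_cols[OF assms, of "\<lambda>c. of_bool (c \<in> minor_cols m v)"]
    unfolding hexagon_def eq by linarith
qed

section \<open>Signed overlaps in the two triangles of the array\<close>

lemma int_card_inter:
  "int (card ({a..b} \<inter> {c..d})) = max 0 (min (int b) (int d) - max (int a) (int c) + 1)"
  by (auto simp: max_def min_def of_nat_diff)

text \<open>
  The sign jumps across certain lines of the array. For \<open>v\<close> in the triangle \<open>i + j \<le> m + 1\<close>, where the
  minors start in the first row (respectively in the triangle \<open>i + j \<ge> m + 1\<close>, where they end in the
  last column), the signed overlap with \<open>v\<close> differs from a function in the kernel of the hexagon by the
  following truncated linear function, on which the hexagon is nonzero only at \<open>v\<close>.
\<close>

fun upper_kink :: "nat \<times> nat \<Rightarrow> nat \<times> nat \<Rightarrow> int" where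
  "upper_kink (i, j) (i', j') = max 0 (min (int i) (int i') - max 0 (int i + int j - int j'))"

fun lower_kink :: "nat \<Rightarrow> nat \<times> nat \<Rightarrow> nat \<times> nat \<Rightarrow> int" where
  "lower_kink m (i, j) (i', j') =
     max 0 (int m + 1 - max (int j) (int j') - max 0 (int m + 1 - int i - int j + int i'))"

lemma overlap_eq:
  "overlap m (i, j) (i', j') = real_of_int (
     max 0 (min (int (min m (i + j - 1))) (int (min m (i' + j' - 1))) - max (int j) (int j') + 1) -
     max 0 (min (int i) (int i') - max (int (Suc (i + j - Suc m))) (int (Suc (i' + j' - Suc m))) + 1))"
  unfolding overlap_def minor_rows.simps minor_cols.simps int_card_inter[symmetric] by simp

lemma overlap_commute: "overlap m u v = overlap m v u"
  by (simp add: overlap_def Int_commute)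

lemma overlap_upper_upper:
  assumes "1 \<le> j" "1 \<le> j'" "i + j \<le> m + 1" "i' + j' \<le> m + 1"
  shows "overlap m (i, j) (i', j') = real_of_int (
    max 0 (min (int i + int j) (int i' + int j') - max (int j) (int j')) - min (int i) (int i'))"
proof -
  have "min m (i + j - 1) = i + j - 1" "min m (i' + j' - 1) = i' + j' - 1"
    "Suc (i + j - Suc m) = 1" "Suc (i' + j' - Suc m) = 1"
    using assms by auto
  then show ?thesis
    unfolding overlap_eq using assms by (simp add: of_nat_diff min_diff_distrib_left[symmetric])
qed

lemma overlap_lower_upper:
  assumes "1 \<le> j'" "i + j > m" "i' + j' \<le> m + 1"
  shows "overlap m (i, j) (i', j') = real_of_int (
    max 0 (int i' + int j' - max (int j) (int j')) - max 0 (min (int i) (int i') + int m + 1 - int i - int j))"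
proof -
  have "int (min m (i + j - 1)) = int m" "int (min m (i' + j' - 1)) = int i' + int j' - 1"
    "int (Suc (i + j - Suc m)) = int i + int j - int m" "int (Suc (i' + j' - Suc m)) = 1"
    using assms by auto
  then show ?thesis
    unfolding overlap_eq using assms by (simp add: algebra_simps)
qed

lemma overlap_lower_lower:
  assumes "i + j > m" "i' + j' > m"
  shows "overlap m (i, j) (i', j') = real_of_int (
    max 0 (int m + 1 - max (int j) (int j')) -
    max 0 (min (int i) (int i') + int m + 1 - max (int i + int j) (int i' + int j')))"
proof -
  have "int (min m (i + j - 1)) = int m" "int (min m (i' + j' - 1)) = int m"
    "int (Suc (i + j - Suc m)) = int i + int j - int m"
    "int (Suc (i' + j' - Suc m)) = int i' + int j' - int m"
    using assms by auto
  moreover have "max (int i + int j - int m) (int i' + int j' - int m) =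
      max (int i + int j) (int i' + int j') - int m"
    by (simp add: max_def)
  ultimately show ?thesis
    unfolding overlap_eq by (simp only:) (simp add: algebra_simps)
qed

text \<open>Equivalently, the kink is 0 where the sign is -1 and minus the overlap where the sign is
  1. The hypotheses admit \<open>i = 0\<close> and \<open>j = m + 1\<close>, where the hexagon may
  have vertices.\<close>

lemma signed_overlap_upper:
  assumes "1 \<le> j" "j \<le> m + 1" "1 \<le> i'" "1 \<le> j'" "i' + j' \<le> m + 1"
  shows "form_sign m (i, j) (i', j') * overlap m (i, j) (i', j') =
    - overlap m (i, j) (i', j') - 2 * real_of_int (upper_kink (i, j) (i', j'))"
proof (cases "i + j \<le> m + 1")
  case True
  then have sign: "form_sign m (i, j) (i', j') = (if i + j > i' + j' \<and> j > j' then -1 else 1)"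
    using assms by auto
  \<comment> \<open>The lines \<open>i = i'\<close>, \<open>j = j'\<close> and
    \<open>i + j = i' + j'\<close> cut the array into six sectors, on each of which the sign is
    constant.\<close>
  consider "i \<le> i'" "j \<le> j'" | "i \<le> i'" "j > j'" "i + j > i' + j'"
    | "i \<le> i'" "j > j'" "i + j \<le> i' + j'" | "i > i'" "j > j'"
    | "i > i'" "j \<le> j'" "i + j > i' + j'" | "i > i'" "j \<le> j'" "i + j \<le> i' + j'"
    by linarith
  then show ?thesis
    unfolding sign overlap_upper_upper[OF assms(1,4) True assms(5)] by cases simp_all
next
  case False
  then have sign: "form_sign m (i, j) (i', j') = (if i > i' \<or> j > j' \<and> i' + j' \<le> m then -1 else 1)"
    using assms by auto
  have eq: "overlap m (i, j) (i', j') = real_of_int (max 0 (int i' + int j' - max (int j) (int j')) -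
      max 0 (min (int i) (int i') + int m + 1 - int i - int j))"
    using False assms by (intro overlap_lower_upper) auto
  consider "i \<le> i'" "j > j'" | "i > i'" "j > j'" | "i > i'" "j \<le> j'"
    using assms False by linarith
  then show ?thesis
    unfolding sign eq using assms False by cases simp_all
qed

text \<open>Equivalently, the kink is 0 where the sign is 1 and the overlap itself where the sign is
  -1.\<close>

lemma signed_overlap_lower:
  assumes "1 \<le> j" "j \<le> m + 1" "1 \<le> i'" "1 \<le> j'" "j' \<le> m" "i' + j' > m"
  shows "form_sign m (i, j) (i', j') * overlap m (i, j) (i', j') =
    overlap m (i, j) (i', j') - 2 * real_of_int (lower_kink m (i, j) (i', j'))"
proof (cases "i + j \<le> m + 1")
  case True
  then have "form_sign m (i, j) (i', j') = 1"
    using assms by auto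
  moreover have "lower_kink m (i, j) (i', j') = 0"
    using True assms by (auto simp: max_def)
  ultimately show ?thesis by simp
next
  case False
  then have sign: "form_sign m (i, j) (i', j') = (if i > i' \<and> i + j > i' + j' then -1 else 1)"
    using assms by auto
  have eq: "overlap m (i, j) (i', j') = real_of_int (max 0 (int m + 1 - max (int j) (int j')) -
      max 0 (min (int i) (int i') + int m + 1 - max (int i + int j) (int i' + int j')))"
    using False assms by (intro overlap_lower_lower) auto
  consider "i \<le> i'" "j \<le> j'" | "i \<le> i'" "j > j'" "i + j > i' + j'"
    | "i \<le> i'" "j > j'" "i + j \<le> i' + j'" | "i > i'" "j > j'"
    | "i > i'" "j \<le> j'" "i + j > i' + j'" | "i > i'" "j \<le> j'" "i + j \<le> i' + j'"
    by linarith
  then show ?thesis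
    unfolding sign eq using assms False by cases simp_all
qed

text \<open>\<open>form_sign\<close> alone is not antisymmetric: both values are 1 if neither minor
  is shifted beyond the other. Then one minor contains the other in rows and columns, and the
  overlap vanishes as a difference of equal sizes.\<close>

lemma signed_overlap_antisym:
  assumes "1 \<le> i" "1 \<le> j" "j \<le> m" "1 \<le> i'" "1 \<le> j'" "j' \<le> m"
  shows "form_sign m (i, j) (i', j') * overlap m (i, j) (i', j') =
    - (form_sign m (i', j') (i, j) * overlap m (i', j') (i, j))"
proof -
  let ?after = "\<lambda>i j i' j'. i > i' \<and> i + j - Suc m > i' + j' - Suc m \<or>
    min m (i + j - 1) > min m (i' + j' - 1) \<and> j > j'"
  have "overlap m (i, j) (i', j') = 0" if neither: "\<not> ?after i j i' j'" "\<not> ?after i' j' i j"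
  proof -
    consider "i + j \<le> m + 1" "i' + j' \<le> m + 1" | "i + j > m" "i' + j' > m"
      | "i + j > m + 1" "i' + j' < m + 1" | "i + j < m + 1" "i' + j' > m + 1"
      by linarith
    then show ?thesis
    proof cases
      case 1
      have e: "min m (i + j - 1) = i + j - 1" "min m (i' + j' - 1) = i' + j' - 1"
        using 1 by auto
      have "min m (i + j - 1) > min m (i' + j' - 1) \<longleftrightarrow> i + j > i' + j'"
        "min m (i' + j' - 1) > min m (i + j - 1) \<longleftrightarrow> i' + j' > i + j"
        unfolding e using assms by linarith+
      then have n: "\<not> (i + j > i' + j' \<and> j > j')" "\<not> (i' + j' > i + j \<and> j' > j)"
        using neither by blast+
      consider "j \<le> j'" "i + j \<ge> i' + j'" | "j \<ge> j'" "i + j \<le> i' + j'"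
        using n by linarith
      then show ?thesis
        using 1 assms by cases (simp_all add: overlap_upper_upper)
    next
      case 2
      have "i + j - Suc m > i' + j' - Suc m \<longleftrightarrow> i + j > i' + j'"
        "i' + j' - Suc m > i + j - Suc m \<longleftrightarrow> i' + j' > i + j"
        using 2 by linarith+
      then have n: "\<not> (i > i' \<and> i + j > i' + j')" "\<not> (i' > i \<and> i' + j' > i + j)"
        using neither by blast+
      consider "i \<le> i'" "i + j \<ge> i' + j'" | "i \<ge> i'" "i + j \<le> i' + j'"
        using n by linarith
      then show ?thesis
        using 2 assms by cases (simp_all add: overlap_lower_lower)
    next
      case 3
      then show ?thesis using neither assms by auto
    next
      case 4
      then show ?thesis using neither assms by auto
    qed
  qed
  moreover have "\<not> (?after i j i' j' \<and> ?after i' j' i j)"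
    by linarith
  moreover have "form_sign m (i, j) (i', j') = (if ?after i j i' j' then -1 else 1)"
    "form_sign m (i', j') (i, j) = (if ?after i' j' i j then -1 else 1)"
    by (rule form_sign.simps)+
  ultimately show ?thesis
    unfolding overlap_commute[of m "(i', j')"]
    by (cases "?after i j i' j'"; cases "?after i' j' i j") (simp_all only:, simp_all)
qed

text \<open>On either side of the line \<open>i = i'\<close> the kink is a combination of functions
  of \<open>j\<close> and of \<open>i + j\<close>, which the hexagon annihilates. Hexagons centred
  on the line are evaluated directly.\<close>

lemma hexagon_upper_kink:
  assumes "1 \<le> i" "2 \<le> j" "1 \<le> i'"
  shows "hexagon (\<lambda>u. real_of_int (upper_kink u (i', j'))) i j = (if (i, j) = (i', j') then -1 else 0)"
proof -
  let ?g = "\<lambda>u. real_of_int (upper_kink u (i', j'))" and ?r = "\<lambda>x. max 0 (real j' - real x)"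
  have below: "?g (x, y) = ?r y - ?r (x + y)" if "x \<le> i'" for x y
    using that by (auto simp: max_def)
  have above: "?g (x, y) = max 0 (real i' + real j' - real (x + y)) - ?r (x + y)" if "x \<ge> i'" for x y
    using that by (auto simp: max_def)
  obtain p q where pq: "i = Suc p" "j = Suc q"
    using assms by (metis One_nat_def Suc_1 Suc_le_D)
  consider "i < i'" | "i > i'" | "i = i'" by linarith
  then show ?thesis
  proof cases
    case 1
    then show ?thesis by (simp add: hexagon_def below pq del: upper_kink.simps)
  next
    case 2
    then show ?thesis by (simp add: hexagon_def above pq del: upper_kink.simps)
  next
    case 3
    then show ?thesis using above[of "i' + 1"] below[of i'] below[of "i' - 1"] pq
      by (simp add: hexagon_def del: upper_kink.simps) (auto simp: max_def)
  qed
qed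

text \<open>As for the upper kink, with the line \<open>j = j'\<close> and functions of
  \<open>i\<close> and of \<open>i + j\<close>.\<close>

lemma hexagon_lower_kink:
  assumes "1 \<le> i" "2 \<le> j" "j \<le> m" "j' \<le> m"
  shows "hexagon (\<lambda>u. real_of_int (lower_kink m u (i', j'))) i j = (if (i, j) = (i', j') then -1 else 0)"
proof -
  let ?g = "\<lambda>u. real_of_int (lower_kink m u (i', j'))"
    and ?r = "\<lambda>x. max 0 (real x - real i' - real m - 1)"
  have right: "?g (x, y) = max 0 (real x - real i') - ?r (x + y)" if "j' \<le> y" "y \<le> m + 1" for x y
    using that by (auto simp: max_def)
  have left: "?g (x, y) = max 0 (real (x + y) - real i' - real j') - ?r (x + y)" if "y \<le> j'" for x y
    using that assms by (auto simp: max_def)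
  obtain p q where pq: "i = Suc p" "j = Suc q"
    using assms by (metis One_nat_def Suc_1 Suc_le_D)
  consider "j < j'" | "j > j'" | "j = j'" by linarith
  then show ?thesis
  proof cases
    case 1
    then show ?thesis using assms by (simp add: hexagon_def left pq del: lower_kink.simps)
  next
    case 2
    then show ?thesis using assms by (simp add: hexagon_def right pq del: lower_kink.simps)
  next
    case 3
    then have y: "j + 1 \<le> m + 1" "j \<le> m + 1" "j' \<le> j" "j' \<le> j + 1" "j - 1 \<le> j'"
      using assms by auto
    show ?thesis
      unfolding hexagon_def right[OF y(4,1)] right[OF y(3,2)] left[OF y(5)]
      using 3 pq by (cases i i' rule: linorder_cases) auto
  qed
qed

section \<open>The initial exchange matrix and its product with the form\<close>

lemma arrow_iff:
  "arrow (i, j) (x, y) \<longleftrightarrow>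
     (x, y) = (i, j + 1) \<or> (i = x + 1 \<and> y = j) \<or> (x = i + 1 \<and> j = y + 1)"
  by (auto elim: arrow.cases intro: arrow.intros[simplified])

lemma cluster_ix_grassmannian: "cluster_ix (grassmannian_seed k n) = {1..k - 1} \<times> {2..n - k}"
  by (simp add: grassmannian_seed_def)

lemma all_ix_grassmannian: "all_ix (grassmannian_seed k n) = {1..k} \<times> {1..n - k}"
  by (auto simp: all_ix_def grassmannian_seed_def)

lemma exch_grassmannian:
  "exch (grassmannian_seed k n) a b = (if arrow a b then 1 else if arrow b a then - 1 else 0)"
  by (simp add: grassmannian_seed_def)

text \<open>As \<open>i < k\<close> and \<open>j \<ge> 2\<close>, a neighbour of
  \<open>(i, j)\<close> outside the array lies in row 0 or in column \<open>n - k + 1\<close>. There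
  \<open>\<phi>\<close> vanishes, so the full hexagon may be used at every cluster vertex.\<close>

lemma sum_exch_grassmannian:
  assumes "(i, j) \<in> cluster_ix (grassmannian_seed k n)"
    and zero: "\<And>y. 1 \<le> y \<Longrightarrow> \<phi> (0, y) = 0" "\<And>x. \<phi> (x, n - k + 1) = 0"
  shows "(\<Sum>b\<in>all_ix (grassmannian_seed k n).
      real_of_int (exch (grassmannian_seed k n) (i, j) b) * \<phi> b) = hexagon \<phi> i j"
proof -
  have ij: "1 \<le> i" "i < k" "2 \<le> j" "j \<le> n - k"
    using assms(1) by (auto simp: cluster_ix_grassmannian)
  let ?N = "{1..k} \<times> {1..n - k}" and ?d = "\<lambda>c b. if b = c then \<phi> b else 0"
  have "real_of_int (exch (grassmannian_seed k n) (i, j) b) * \<phi> b =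
      ?d (i, j + 1) b + ?d (i - 1, j) b + ?d (i + 1, j - 1) b
      - ?d (i, j - 1) b - ?d (i + 1, j) b - ?d (i - 1, j + 1) b" for b
  proof -
    obtain p q where pq: "i = Suc p" "j = Suc (Suc q)"
      using ij by (metis One_nat_def Suc_1 Suc_le_D Suc_le_mono)
    have out: "arrow (i, j) b \<longleftrightarrow> b = (i, j + 1) \<or> b = (i - 1, j) \<or> b = (i + 1, j - 1)"
      and into: "arrow b (i, j) \<longleftrightarrow> b = (i, j - 1) \<or> b = (i + 1, j) \<or> b = (i - 1, j + 1)"
      unfolding pq by (cases b; simp add: arrow_iff; linarith)+
    consider "b = (i, j + 1)" | "b = (i - 1, j)" | "b = (i + 1, j - 1)"
      | "b = (i, j - 1)" | "b = (i + 1, j)" | "b = (i - 1, j + 1)"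
      | "b \<notin> {(i, j + 1), (i - 1, j), (i + 1, j - 1), (i, j - 1), (i + 1, j), (i - 1, j + 1)}"
      by blast
    then show ?thesis
      unfolding exch_grassmannian out into unfolding pq by cases simp_all
  qed
  moreover have "(\<Sum>b\<in>?N. ?d c b) = (if c \<in> ?N then \<phi> c else 0)" for c
    by (simp add: sum.delta')
  ultimately have "(\<Sum>b\<in>all_ix (grassmannian_seed k n).
      real_of_int (exch (grassmannian_seed k n) (i, j) b) * \<phi> b) =
      (if (i, j + 1) \<in> ?N then \<phi> (i, j + 1) else 0) + (if (i - 1, j) \<in> ?N then \<phi> (i - 1, j) else 0)
      + \<phi> (i + 1, j - 1) - \<phi> (i, j - 1) - \<phi> (i + 1, j)
      - (if (i - 1, j + 1) \<in> ?N then \<phi> (i - 1, j + 1) else 0)"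
    using ij by (simp only: all_ix_grassmannian sum.distrib sum_subtractf) auto
  also have "(if (i, j + 1) \<in> ?N then \<phi> (i, j + 1) else 0) = \<phi> (i, j + 1)"
    using ij zero(2)[of i] by (cases "j = n - k") auto
  also have "(if (i - 1, j) \<in> ?N then \<phi> (i - 1, j) else 0) = \<phi> (i - 1, j)"
    using ij zero(1)[of j] by (cases "i = 1") auto
  also have "(if (i - 1, j + 1) \<in> ?N then \<phi> (i - 1, j + 1) else 0) = \<phi> (i - 1, j + 1)"
    using ij zero(1)[of "j + 1"] zero(2)[of "i - 1"] by (cases "j = n - k"; cases "i = 1") auto
  finally show ?thesis
    by (simp add: hexagon_def)
qed

lemma hexagon_signed_overlap:
  assumes "1 \<le> i" "2 \<le> j" "j \<le> m" "1 \<le> i'" "1 \<le> j'" "j' \<le> m"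
  shows "hexagon (\<lambda>u. form_sign m u (i', j') * overlap m u (i', j')) i j =
    (if (i, j) = (i', j') then 2 else 0)"
proof (cases "i' + j' \<le> m + 1")
  case True
  then have "hexagon (\<lambda>u. form_sign m u (i', j') * overlap m u (i', j')) i j =
      - hexagon (\<lambda>u. overlap m u (i', j')) i j
      - 2 * hexagon (\<lambda>u. real_of_int (upper_kink u (i', j'))) i j"
    using assms by (simp add: hexagon_def signed_overlap_upper del: form_sign.simps upper_kink.simps)
  then show ?thesis
    using assms by (simp add: hexagon_overlap hexagon_upper_kink)
next
  case False
  then have "hexagon (\<lambda>u. form_sign m u (i', j') * overlap m u (i', j')) i j =
      hexagon (\<lambda>u. overlap m u (i', j')) i j
      - 2 * hexagon (\<lambda>u. real_of_int (lower_kink m u (i', j'))) i j"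
    using assms by (simp add: hexagon_def signed_overlap_lower del: form_sign.simps lower_kink.simps)
  then show ?thesis
    using assms by (simp add: hexagon_overlap hexagon_lower_kink)
qed

lemma sgn_sum_antisym: "sgn_sum A B = - sgn_sum B A"
proof -
  have "sgn_diff a b = - sgn_diff b a" for a b
    by (simp add: sgn_diff_def sgn_if)
  then have "sgn_sum A B = (\<Sum>a\<in>A. \<Sum>b\<in>B. - sgn_diff b a)"
    unfolding sgn_sum_def by (intro sum.cong[OF HOL.refl])
  then show ?thesis
    unfolding sgn_sum_def by (subst sum.swap) (simp add: sum_negf)
qed

lemma hexagon_initial_form:
  assumes "1 \<le> i" "2 \<le> j" "j \<le> m" "1 \<le> i'" "1 \<le> j'" "j' \<le> m"
  shows "hexagon (\<lambda>u. initial_form m \<kappa> \<mu> u (i', j')) i j = (if (i, j) = (i', j') then 2 * \<kappa> else 0)"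
proof -
  let ?v = "(i', j')"
  have "hexagon (\<lambda>u. initial_form m \<kappa> \<mu> u ?v) i j =
      \<kappa> * hexagon (\<lambda>u. form_sign m u ?v * overlap m u ?v) i j
      - \<mu> * (hexagon (\<lambda>u. sgn_sum (minor_rows m u) (minor_rows m ?v)) i j
           + hexagon (\<lambda>u. sgn_sum (minor_cols m u) (minor_cols m ?v)) i j)"
    by (simp add: hexagon_def initial_form_def algebra_simps
        del: form_sign.simps minor_rows.simps minor_cols.simps)
  also have "hexagon (\<lambda>u. sgn_sum (minor_rows m u) (minor_rows m ?v)) i j = 0"
    unfolding sgn_sum_def by (rule hexagon_sum_rows) (use assms in auto)
  also have "hexagon (\<lambda>u. sgn_sum (minor_cols m u) (minor_cols m ?v)) i j = 0"
    unfolding sgn_sum_def by (rule hexagon_sum_cols) (use assms in auto)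
  finally show ?thesis
    using hexagon_signed_overlap[OF assms] by simp
qed

lemma initial_form_antisym:
  assumes "u \<in> {1..k} \<times> {1..m}" "v \<in> {1..k} \<times> {1..m}"
  shows "initial_form m \<kappa> \<mu> u v = - initial_form m \<kappa> \<mu> v u"
proof -
  obtain i j i' j' where uv: "u = (i, j)" "v = (i', j')"
    by (cases u, cases v)
  have "form_sign m u v * overlap m u v = - (form_sign m v u * overlap m v u)"
    using assms unfolding uv by (intro signed_overlap_antisym) auto
  then have "\<kappa> * form_sign m u v * overlap m u v = - (\<kappa> * form_sign m v u * overlap m v u)"
    by (simp add: mult.assoc)
  then show ?thesis
    unfolding initial_form_def
    using sgn_sum_antisym[of "minor_rows m u" "minor_rows m v"]
      sgn_sum_antisym[of "minor_cols m u" "minor_cols m v"] by (simp add: algebra_simps)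
qed

lemma initial_form_boundary:
  "1 \<le> y \<Longrightarrow> initial_form m \<kappa> \<mu> (0, y) v = 0" "initial_form m \<kappa> \<mu> (x, m + 1) v = 0"
  by (cases v; simp add: initial_form_def overlap_def sgn_sum_def)+

lemma compatible_form_grassmannian:
  "compatible_form (grassmannian_seed k n) (2 * \<kappa>) (initial_form (n - k) \<kappa> \<mu>)"
  unfolding compatible_form_def
proof (intro conjI ballI)
  show "finite (all_ix (grassmannian_seed k n))"
    by (simp add: all_ix_grassmannian)
  show "initial_form (n - k) \<kappa> \<mu> i j = - initial_form (n - k) \<kappa> \<mu> j i"
    if "i \<in> all_ix (grassmannian_seed k n)" "j \<in> all_ix (grassmannian_seed k n)" for i j
    using that unfolding all_ix_grassmannian by (rule initial_form_antisym)
  show "exch (grassmannian_seed k n) i j = - exch (grassmannian_seed k n) j i" for i j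
    by (cases i; cases j) (auto simp: exch_grassmannian arrow_iff)
  show "(\<Sum>b\<in>all_ix (grassmannian_seed k n). real_of_int (exch (grassmannian_seed k n) a b) *
      initial_form (n - k) \<kappa> \<mu> b c) = (if a = c then 2 * \<kappa> else 0)"
    if a: "a \<in> cluster_ix (grassmannian_seed k n)" and c: "c \<in> all_ix (grassmannian_seed k n)" for a c
  proof -
    obtain i j i' j' where ac: "a = (i, j)" "c = (i', j')"
      by (cases a, cases c)
    have "(\<Sum>b\<in>all_ix (grassmannian_seed k n). real_of_int (exch (grassmannian_seed k n) (i, j) b) *
        initial_form (n - k) \<kappa> \<mu> b (i', j')) = hexagon (\<lambda>b. initial_form (n - k) \<kappa> \<mu> b (i', j')) i j"
      by (rule sum_exch_grassmannian[OF a[unfolded ac(1)]]) (rule initial_form_boundary; assumption?)+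
    also have "\<dots> = (if (i, j) = (i', j') then 2 * \<kappa> else 0)"
      using a c unfolding ac cluster_ix_grassmannian all_ix_grassmannian
      by (intro hexagon_initial_form) auto
    finally show ?thesis unfolding ac .
  qed
qed

section \<open>The bracket in the coordinates of the standard cell\<close>

text \<open>Rotation depends on \<open>r\<close> modulo the length, which turns \<open>cyc\<close>
  into a finite disjunction for lists of length 3 and 4.\<close>

lemma cyc_bounded:
  assumes "xs \<noteq> []"
  shows "cyc xs \<longleftrightarrow> (\<exists>r<length xs. sorted_wrt (<) (rotate r xs))"
proof
  assume "cyc xs"
  then obtain r where "sorted_wrt (<) (rotate r xs)" by (auto simp: cyc_def)
  then have "sorted_wrt (<) (rotate (r mod length xs) xs)"
    by (simp flip: rotate_conv_mod)
  then show "\<exists>r<length xs. sorted_wrt (<) (rotate r xs)"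
    using assms by (intro exI[of _ "r mod length xs"]) simp
qed (auto simp: cyc_def)

lemma cyc_3:
  "cyc [a, b, c] \<longleftrightarrow> (a < b \<and> b < c) \<or> (b < c \<and> c < a) \<or> (c < a \<and> a < b)"
  by (auto simp: cyc_bounded Ex_less_Suc)

lemma cyc_4:
  "cyc [a, b, c, d] \<longleftrightarrow> (a < b \<and> b < c \<and> c < d) \<or> (b < c \<and> c < d \<and> d < a) \<or>
     (c < d \<and> d < a \<and> a < b) \<or> (d < a \<and> a < b \<and> b < c)"
  by (simp add: cyc_bounded Ex_less_Suc sorted_wrt2_simps del: sorted_wrt.simps(2)) blast

text \<open>Row indices of the standard cell precede its column indices, so the cyclic conditions
  depend on the linear order of \<open>i\<close>, \<open>i'\<close> and of \<open>j\<close>,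
  \<open>j'\<close> alone.\<close>

lemma s_par_standard:
  assumes "i \<le> k" "i' \<le> k" "k < j" "k < j'"
  shows "s_par i j i' j' = (sgn_diff i i' - sgn_diff j j') / 2"
  using assms
  by (cases i i' rule: linorder_cases; cases j j' rule: linorder_cases)
    (simp_all add: s_par_def cyc_4 cyc_3 sgn_diff_def)

lemma s_cross_standard:
  assumes "i \<le> k" "i' \<le> k" "k < j" "k < j'"
  shows "s_cross i j i' j' = - (sgn_diff i i' + sgn_diff j j') / 2"
  using assms
  by (cases i i' rule: linorder_cases; cases j j' rule: linorder_cases)
    (simp_all add: s_cross_def cyc_4 cyc_3 sgn_diff_def)

lemma nth_elem_standard:
  assumes "p \<in> {1..k}"
  shows "nth_elem {1..k} p = p"
proof -
  have "sorted_list_of_set {1..k} = [1..<Suc k]"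
    using sorted_list_of_set_range[of 1 "Suc k"] by (simp add: atLeastLessThanSuc_atLeastAtMost)
  then show ?thesis
    using assms by (simp add: nth_elem_def del: upt_Suc)
qed

text \<open>The generic matrix begins with the identity; comparing the first \<open>k\<close>
  columns of \<open>A * generic_matrix k n\<close> forces \<open>A\<close> to be the
  identity.\<close>

lemma cell_matrix_standard:
  assumes "k < n"
  shows "cell_matrix k n {1..k} = generic_matrix k n"
  unfolding cell_matrix_def
proof (rule the_equality, intro conjI ballI bexI)
  let ?G = "generic_matrix k n"
  show "invertible_mat (1\<^sub>m k)" "?G = 1\<^sub>m k * ?G" "1\<^sub>m k \<in> carrier_mat k k"
    by (auto simp: generic_matrix_def invertible_mat_def square_mat.simps inverts_mat_def intro!: exI[of _ "1\<^sub>m k"])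
  show "?G $$ (p - 1, nth_elem {1..k} q - 1) = (if p = q then 1 else 0)"
    if "p \<in> {1..k}" "q \<in> {1..k}" for p q
    unfolding nth_elem_standard[OF that(2)] using assms that by (auto simp: generic_matrix_def)
next
  let ?G = "generic_matrix k n"
  fix M :: "ratfun mat"
  assume M: "(\<exists>A\<in>carrier_mat k k. invertible_mat A \<and> M = A * ?G) \<and>
    (\<forall>p\<in>{1..k}. \<forall>q\<in>{1..k}. M $$ (p - 1, nth_elem {1..k} q - 1) = (if p = q then 1 else 0))"
  then obtain A where A: "A \<in> carrier_mat k k" "M = A * ?G" by blast
  have "A = 1\<^sub>m k"
  proof (rule eq_matI)
    fix a b assume "a < dim_row (1\<^sub>m k :: ratfun mat)" "b < dim_col (1\<^sub>m k :: ratfun mat)"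
    then have ab: "a < k" "b < k" by simp_all
    have "A $$ (a, b) = (\<Sum>c = 0..<k. A $$ (a, c) * (if c = b then 1 else 0))"
      using ab by (simp add: if_distrib cong: if_cong)
    also have "\<dots> = M $$ (a, b)"
      using A ab assms by (simp add: generic_matrix_def scalar_prod_def)
    also have "\<dots> = (if a = b then 1 else 0)"
      using M[THEN conjunct2, rule_format, of "Suc a" "Suc b"] ab
      by (simp add: nth_elem_standard del: One_nat_def)
    finally show "A $$ (a, b) = 1\<^sub>m k $$ (a, b)" using ab by simp
  qed (use A in auto)
  then show "M = ?G" using A by (simp add: generic_matrix_def)
qed

lemma cell_coord_standard:
  assumes "p \<in> {1..k}" "j \<in> {1..n - k}"
  shows "cell_coord k n {1..k} p (k + j) = yvar p j"
proof -
  have "k < n" using assms by auto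
  then show ?thesis
    unfolding cell_coord_def cell_matrix_standard[OF \<open>k < n\<close>]
    using assms by (auto simp: generic_matrix_def)
qed

lemma poisson_subfield_cell:
  assumes "grassmannian_bracket k n \<alpha> \<beta> br"
  shows "poisson_subfield (cell_field k (n - k)) br"
  using assms
  by unfold_locales (auto simp: grassmannian_bracket_def
      intro: cell_field_const cell_field_add cell_field_mult cell_field_inverse)

text \<open>The formula of the cell with \<open>I = {1..k}\<close>, in the shape required by
  \<open>br_minors\<close>. Column \<open>c\<close> of the matrix of the \<open>yvar\<close> is
  column \<open>k + c\<close> of the representative.\<close>

lemma br_yvar:
  assumes br: "grassmannian_bracket k n \<alpha> \<beta> br"
    and a: "a \<in> {1..k}" and b: "b \<in> {1..k}" and c: "c \<in> {1..n - k}" and d: "d \<in> {1..n - k}"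
  shows "br (yvar a c) (yvar b d) =
    const ((\<alpha> - \<beta>) / 2 * (sgn_diff a b - sgn_diff c d)) * yvar a d * yvar b c -
    const ((\<alpha> + \<beta>) / 2 * (sgn_diff a b + sgn_diff c d)) * yvar a c * yvar b d"
proof -
  let ?I = "{1..k}"
  have "br (cell_coord k n ?I a (k + c)) (cell_coord k n ?I b (k + d)) =
      const ((\<alpha> - \<beta>) * s_par (nth_elem ?I a) (k + c) (nth_elem ?I b) (k + d))
        * cell_coord k n ?I a (k + d) * cell_coord k n ?I b (k + c)
      + const ((\<alpha> + \<beta>) * s_cross (nth_elem ?I a) (k + c) (nth_elem ?I b) (k + d))
        * cell_coord k n ?I a (k + c) * cell_coord k n ?I b (k + d)"
  proof -
    have "?I \<subseteq> {1..n} \<and> card ?I = k" "k + c \<in> {1..n} - ?I" "k + d \<in> {1..n} - ?I"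
      using a c d by auto
    then show ?thesis
      using br a b unfolding grassmannian_bracket_def by blast
  qed
  moreover have "s_par a (k + c) b (k + d) = (sgn_diff a b - sgn_diff c d) / 2"
    "s_cross a (k + c) b (k + d) = - (sgn_diff a b + sgn_diff c d) / 2"
    using a b c d s_par_standard[of a k b "k + c" "k + d"] s_cross_standard[of a k b "k + c" "k + d"]
    by (simp_all add: sgn_diff_def)
  moreover have "(\<alpha> - \<beta>) * ((sgn_diff a b - sgn_diff c d) / 2) = (\<alpha> - \<beta>) / 2 * (sgn_diff a b - sgn_diff c d)"
    "(\<alpha> + \<beta>) * (- (sgn_diff a b + sgn_diff c d) / 2) = - ((\<alpha> + \<beta>) / 2 * (sgn_diff a b + sgn_diff c d))"
    by (simp_all add: field_simps)
  ultimately show ?thesis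
    by (simp only: cell_coord_standard[OF a c] cell_coord_standard[OF a d] cell_coord_standard[OF b c]
        cell_coord_standard[OF b d] nth_elem_standard[OF a] nth_elem_standard[OF b] const_uminus) simp
qed

section \<open>The initial cluster as a log-canonical seed\<close>

lemma is_minor_minor_F:
  assumes br: "grassmannian_bracket k n \<alpha> \<beta> br"
    and ij: "i \<in> {1..k}" "j \<in> {1..n - k}"
  shows "\<exists>cof. poisson_subfield.is_minor (cell_field k (n - k)) br yvar
    (minor_rows (n - k) (i, j)) (minor_cols (n - k) (i, j)) cof (minor_F (n - k) i j)"
proof -
  interpret poisson_subfield "cell_field k (n - k)" br
    by (rule poisson_subfield_cell[OF br])
  let ?l = "minor_l (n - k) i j"
  \<comment> \<open>With \<open>?l\<close> the smaller of \<open>i - 1\<close> and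
    \<open>n - k - j\<close>, the first row \<open>i - ?l\<close> is the larger of 1 and
    \<open>i + j - (n - k)\<close>.\<close>
  have rows: "minor_rows (n - k) (i, j) = {i - ?l..<i - ?l + (?l + 1)}"
    and cols: "minor_cols (n - k) (i, j) = {j..<j + (?l + 1)}"
    using ij by (auto simp: minor_l_def)
  have shift: "bij_betw ((+) x) {..<N} {x..<x + N}" for x N :: nat
    by (simp add: bij_betw_def lessThan_atLeast0 add.commute)
  have "yvar a b \<in> cell_field k (n - k)"
    if "a \<in> minor_rows (n - k) (i, j)" "b \<in> minor_cols (n - k) (i, j)" for a b
    using that ij by (intro cell_field_yvar) auto
  note entries = this[unfolded rows cols]
  show ?thesis
    unfolding rows cols minor_F_def Let_def
    by (rule is_minor_det[OF _ shift shift entries]) simp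
qed

lemma powi_minus_one_const: "(- 1 :: ratfun) powi e = const ((- 1) powi e)"
  by (simp add: power_int_minus_left const_uminus)

lemma log_canonical_seed_grassmannian:
  assumes br: "grassmannian_bracket k n \<alpha> \<beta> br"
  shows "poisson_subfield.log_canonical_seed (cell_field k (n - k)) br (grassmannian_seed k n)
    (\<alpha> - \<beta>) (initial_form (n - k) ((\<alpha> - \<beta>) / 2) ((\<alpha> + \<beta>) / 2))"
proof -
  let ?m = "n - k" and ?\<kappa> = "(\<alpha> - \<beta>) / 2" and ?\<mu> = "(\<alpha> + \<beta>) / 2"
  interpret poisson_subfield "cell_field k ?m" br
    by (rule poisson_subfield_cell[OF br])
  have F: "log_canonical (initial_form ?m ?\<kappa> ?\<mu> (i, j) (i', j')) (minor_F ?m i j) (minor_F ?m i' j')"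
    if ij: "i \<in> {1..k}" "j \<in> {1..?m}" and ij': "i' \<in> {1..k}" "j' \<in> {1..?m}" for i j i' j'
  proof -
    let ?u = "(i, j)" and ?v = "(i', j')"
    obtain cof cof' where f: "is_minor yvar (minor_rows ?m ?u) (minor_cols ?m ?u) cof (minor_F ?m i j)"
      and g: "is_minor yvar (minor_rows ?m ?v) (minor_cols ?m ?v) cof' (minor_F ?m i' j')"
      using is_minor_minor_F[OF br ij] is_minor_minor_F[OF br ij'] by blast
    have "br (minor_F ?m i j) (minor_F ?m i' j') =
        const (initial_form ?m ?\<kappa> ?\<mu> ?u ?v) * minor_F ?m i j * minor_F ?m i' j'"
      unfolding initial_form_def overlap_def sgn_sum_def
    proof (rule br_minors[OF f g])
      show "br (yvar a c) (yvar b d) =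
          const (?\<kappa> * (sgn_diff a b - sgn_diff c d)) * yvar a d * yvar b c -
          const (?\<mu> * (sgn_diff a b + sgn_diff c d)) * yvar a c * yvar b d"
        if "a \<in> minor_rows ?m ?u" "c \<in> minor_cols ?m ?u" "b \<in> minor_rows ?m ?v" "d \<in> minor_cols ?m ?v"
        for a b c d
        using that ij ij' by (intro br_yvar[OF br]) auto
      show "sgn_diff a b = form_sign ?m ?u ?v"
        if "a \<in> minor_rows ?m ?u - minor_rows ?m ?v" "b \<in> minor_rows ?m ?v - minor_rows ?m ?u" for a b
        using that ij ij' by (intro form_sign_rows) auto
      show "sgn_diff c d = form_sign ?m ?u ?v"
        if "c \<in> minor_cols ?m ?u - minor_cols ?m ?v" "d \<in> minor_cols ?m ?v - minor_cols ?m ?u" for c d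
        using that ij ij' by (intro form_sign_cols) auto
    qed
    then show ?thesis
      using f g by (simp add: log_canonical_def is_minor_def)
  qed
  have sgn: "signed_f k ?m i j = const ((-1) powi ((int k - int i) * (int (minor_l ?m i j) - 1))) * minor_F ?m i j"
    for i j
    by (simp add: signed_f_def powi_minus_one_const)
  have "log_canonical (initial_form ?m ?\<kappa> ?\<mu> u v)
      (var (grassmannian_seed k n) u) (var (grassmannian_seed k n) v)"
    if "u \<in> {1..k} \<times> {1..?m}" "v \<in> {1..k} \<times> {1..?m}" for u v
  proof -
    obtain i j i' j' where uv: "u = (i, j)" "v = (i', j')"
      by (cases u, cases v)
    have ij: "i \<in> {1..k}" "j \<in> {1..?m}" "i' \<in> {1..k}" "j' \<in> {1..?m}"
      using that by (auto simp: uv)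
    \<comment> \<open>The sign of each variable is a constant factor. It is absorbed in the first
      argument, so the pair is swapped to treat the second.\<close>
    have "log_canonical (initial_form ?m ?\<kappa> ?\<mu> u v) (signed_f k ?m i j) (minor_F ?m i' j')"
      unfolding sgn uv by (intro log_canonical_const_mult F ij)
    then have "log_canonical (- initial_form ?m ?\<kappa> ?\<mu> u v) (signed_f k ?m i' j') (signed_f k ?m i j)"
      unfolding sgn[of i' j'] by (intro log_canonical_const_mult log_canonical_sym)
    from log_canonical_sym[OF this] show ?thesis
      by (simp add: grassmannian_seed_def uv)
  qed
  moreover have "compatible_form (grassmannian_seed k n) (\<alpha> - \<beta>) (initial_form ?m ?\<kappa> ?\<mu>)"
  proof -
    have "2 * ?\<kappa> = \<alpha> - \<beta>" by simp
    then show ?thesis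
      using compatible_form_grassmannian[of k n ?\<kappa> ?\<mu>] by (simp only:)
  qed
  ultimately show ?thesis
    unfolding log_canonical_seed_def all_ix_grassmannian by blast
qed

theorem theorem5p4:
  fixes k n :: nat and \<alpha> \<beta> :: real and br :: "ratfun \<Rightarrow> ratfun \<Rightarrow> ratfun"
  assumes "1 \<le> k" and "k < n"
    and "grassmannian_bracket k n \<alpha> \<beta> br"
  shows "compatible br (grassmannian_seed k n)"
proof -
  interpret poisson_subfield "cell_field k (n - k)" br
    by (rule poisson_subfield_cell[OF assms(3)])
  show ?thesis
    by (rule log_canonical_seed_compatible[OF log_canonical_seed_grassmannian[OF assms(3)]])
qed

end
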